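(* Let $X$ be a generalized Banach space, let $S$ be a nonempty, closed and convex subset of $X$, and let $T:S\to S$ be a weakly sequentially continuous mapping. If $T(S)$ is relatively weakly compact, then $T$ has a fixed point in $S$.
   Context: $\mathbb{R}^n$ is ordered componentwise: $x\le y$ iff $x_i\le y_i$ for all $i$. A generalized Banach space (in the sense of Perov) is a real vector space $X$ with a vector-valued norm $\|\cdot\|=(\|\cdot\|_1,\dots,\|\cdot\|_n):X\to\mathbb{R}^n_+$ (i.e. $\|x\|=0$ iff $x=0$, $\|\lambda x\|=|\lambda|\|x\|$, $\|x+y\|\le\|x\|+\|y\|$ componentwise) that is complete for the associated topology (the one given by the scalar norm $\max_i\|x\|_i$). "Closed" refers to this topology. The weak topology of $X$ is the coarsest topology making all continuous linear functionals on $X$ continuous; $x_k\rightharpoonup x$ denotes weak convergence. A map $T:S\to X$, $S\subseteq X$, is weakly sequentially continuous if $x_k\rightharpoonup x$ with $x_k,x\in S$ implies $Tx_k\rightharpoonup Tx$. A set is relatively weakly compact if its weak closure is weakly compact. *)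

theory Defs
  imports "HOL-Analysis.Analysis"
begin

text \<open>
  The vector norm takes values in \<open>real ^ 'n\<close>, whose library order is the componentwise one.
\<close>

locale generalized_normed_space =
  fixes N :: "'a::real_vector \<Rightarrow> real ^ 'n"
  assumes N_nonneg: "0 \<le> N x"
    and N_eq_zero_iff: "N x = 0 \<longleftrightarrow> x = 0"
    and N_scaleR: "N (c *\<^sub>R x) = \<bar>c\<bar> *\<^sub>R N x"
    and N_triangle: "N (x + y) \<le> N x + N y"

definition gdist :: "('a::real_vector \<Rightarrow> real ^ 'n) \<Rightarrow> 'a \<Rightarrow> 'a \<Rightarrow> real"
  where "gdist N x y = (MAX i. N (x - y) $ i)"

lemma (in generalized_normed_space) Metric_space_gdist: "Metric_space UNIV (gdist N)"
proof
  have comp: "N x $ i \<le> (MAX i. N x $ i)" for x i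
    by (rule Max_ge) auto
  show "0 \<le> gdist N x y" for x y
  proof -
    have "0 \<le> N (x - y) $ i" for i
      using N_nonneg[of "x - y"] by (simp add: less_eq_vec_def)
    then show ?thesis
      unfolding gdist_def by (rule order_trans[OF _ comp])
  qed
  have "N (y - x) = N (x - y)" for x y
    using N_scaleR[of "-1" "x - y"] by simp
  then show "gdist N x y = gdist N y x" for x y
    by (simp add: gdist_def)
  show "gdist N x y = 0 \<longleftrightarrow> x = y" for x y
  proof
    assume "gdist N x y = 0"
    then have "N (x - y) $ i \<le> 0" for i
      using comp[of "x - y" i] unfolding gdist_def by linarith
    moreover have "0 \<le> N (x - y) $ i" for i
      using N_nonneg[of "x - y"] by (simp add: less_eq_vec_def)
    ultimately have "N (x - y) $ i = 0" for i
      by (rule antisym)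
    then have "N (x - y) = 0" by (simp add: vec_eq_iff)
    then show "x = y" using N_eq_zero_iff[of "x - y"] by simp
  next
    assume "x = y"
    then show "gdist N x y = 0"
      using N_eq_zero_iff[of 0] by (simp add: gdist_def)
  qed
  show "gdist N x z \<le> gdist N x y + gdist N y z" for x y z
  proof -
    have "N (x - z) $ i \<le> gdist N x y + gdist N y z" for i
    proof -
      have "N (x - z) $ i \<le> N (x - y) $ i + N (y - z) $ i"
        using N_triangle[of "x - y" "y - z"] by (simp add: less_eq_vec_def)
      also have "\<dots> \<le> gdist N x y + gdist N y z"
        unfolding gdist_def by (intro add_mono comp)
      finally show ?thesis .
    qed
    then show ?thesis
      unfolding gdist_def[of N x z] by (intro Max.boundedI) auto
  qed
qed

locale generalized_banach_space = generalized_normed_space +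
  assumes complete: "Metric_space.mcomplete UNIV (gdist N)"

definition gtopology :: "('a::real_vector \<Rightarrow> real ^ 'n) \<Rightarrow> 'a topology"
  where "gtopology N = Metric_space.mtopology UNIV (gdist N)"

definition weak_topology :: "('a::real_vector \<Rightarrow> real ^ 'n) \<Rightarrow> 'a topology"
  where "weak_topology N = topology_generated_by
    {f -` U | f U. linear f \<and> continuous_map (gtopology N) euclideanreal f \<and> open U}"

lemma topspace_weak_topology: "topspace (weak_topology N) = UNIV"
proof -
  have "linear (\<lambda>_::'a. 0 :: real)"
    and "continuous_map (gtopology N) euclideanreal (\<lambda>_. 0)"
    by (simp_all add: linear_zero)
  then have "(\<lambda>_. 0 :: real) -` UNIV \<in> {f -` U | f U. linear (f :: 'a \<Rightarrow> real)
      \<and> continuous_map (gtopology N) euclideanreal f \<and> open U}"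
    unfolding mem_Collect_eq
    by - (rule exI[of _ "\<lambda>_. 0"], rule exI[of _ UNIV], intro conjI refl open_UNIV)
  then have "(\<lambda>_. 0 :: real) -` UNIV \<subseteq> topspace (weak_topology N)"
    unfolding weak_topology_def topology_generated_by_topspace by (rule Union_upper)
  then show ?thesis by auto
qed

definition weakly_sequentially_continuous_on ::
    "('a::real_vector \<Rightarrow> real ^ 'n) \<Rightarrow> 'a set \<Rightarrow> ('a \<Rightarrow> 'a) \<Rightarrow> bool"
  where "weakly_sequentially_continuous_on N S T \<longleftrightarrow>
    (\<forall>x l. (\<forall>k. x k \<in> S) \<and> l \<in> S \<and> limitin (weak_topology N) x l sequentially
      \<longrightarrow> limitin (weak_topology N) (\<lambda>k. T (x k)) (T l) sequentially)"

definition relatively_weakly_compact ::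
    "('a::real_vector \<Rightarrow> real ^ 'n) \<Rightarrow> 'a set \<Rightarrow> bool"
  where "relatively_weakly_compact N A \<longleftrightarrow>
    compactin (weak_topology N) (weak_topology N closure_of A)"

end

theory Submission imports Defs begin

text \<open>
  A countable set \<open>D \<subseteq> S\<close> closed under \<open>T\<close> and rational convex combinations has a closure \<open>K\<close> that is
  convex, separable and, by weak sequential continuity and Mazur's theorem, invariant under \<open>T\<close>;
  moreover \<open>T ` K\<close> lies in a weakly compact set \<open>C \<subseteq> K\<close>.
  Projecting \<open>C\<close> onto finite-dimensional simplices and applying Brouwer's theorem gives points \<open>z k\<close>
  of the convex hull of \<open>C\<close> such that \<open>z k\<close> and \<open>T (z k)\<close> asymptotically agree on each functional of
  a sequence \<open>f\<close>, chosen so that every functional is on \<open>K\<close> a multiple of a pointwise limit of a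
  subsequence of \<open>f\<close>. By weak compactness some subsequence of \<open>T (z k)\<close> converges along each \<open>f j\<close>
  to a point \<open>y\<close> of \<open>C\<close>, and dominated convergence for averages over \<open>C\<close> turns this into weak
  convergence of both \<open>z k\<close> and \<open>T (z k)\<close> to \<open>y\<close>. Hence \<open>T y = y\<close>. In this way neither the
  Krein--Smulian nor the Eberlein--Smulian theorem is needed.
\<close>

section \<open>Linear functionals below sublinear ones\<close>

definition sublinear :: "('a::real_vector \<Rightarrow> real) \<Rightarrow> bool"
  where "sublinear p \<longleftrightarrow> (\<forall>x y. p (x + y) \<le> p x + p y) \<and> (\<forall>c x. 0 < c \<longrightarrow> p (c *\<^sub>R x) = c * p x)"

lemma sublinearD:
  assumes "sublinear p"
  shows "p (x + y) \<le> p x + p y" and "0 \<le> c \<Longrightarrow> p (c *\<^sub>R x) = c * p x"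
    and "- p (- x) \<le> p x" and "p 0 = 0"
proof -
  show add: "p (x + y) \<le> p x + p y" for x y
    using assms by (simp add: sublinear_def)
  have "p (2 *\<^sub>R 0) = 2 * p 0"
    using assms unfolding sublinear_def by (metis zero_less_numeral)
  then show zero: "p 0 = 0" by simp
  show "p (c *\<^sub>R x) = c * p x" if "0 \<le> c" for c x
    using assms that zero unfolding sublinear_def by (cases "c = 0") auto
  show "- p (- x) \<le> p x"
    using add[of x "- x"] zero by simp
qed

lemma sublinearI:
  assumes add: "\<And>x y. p (x + y) \<le> p x + p y"
    and hom: "\<And>c x. 0 < c \<Longrightarrow> p (c *\<^sub>R x) \<le> c * p x"
  shows "sublinear p"
proof -
  have "p (c *\<^sub>R x) = c * p x" if "0 < c" for c x
  proof (rule antisym)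
    show "p (c *\<^sub>R x) \<le> c * p x" using hom that .
    have "p x \<le> p (c *\<^sub>R x) / c"
      using hom[of "inverse c" "c *\<^sub>R x"] that by (simp add: divide_inverse_commute)
    then show "c * p x \<le> p (c *\<^sub>R x)"
      using that by (simp add: le_divide_eq mult.commute)
  qed
  with add show ?thesis by (simp add: sublinear_def)
qed

text \<open>The lower bound \<open>r\<close> of \<open>p\<close> on \<open>A\<close> keeps the
  infimum \<open>q\<close> finite. Singletons \<open>A\<close> give linearity of minimal sublinear
  functionals; the norm with \<open>z - K\<close> gives separation, so one construction carries both
  halves of the Hahn-Banach argument.\<close>

lemma sublinear_decrease:
  fixes p :: "'a::real_vector \<Rightarrow> real"
  assumes p: "sublinear p" and A: "convex A" "A \<noteq> {}" and r: "\<And>a. a \<in> A \<Longrightarrow> r \<le> p a"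
  shows "\<exists>q. sublinear q \<and> (\<forall>x. q x \<le> p x) \<and> (\<forall>a\<in>A. q (- a) \<le> - r)"
proof -
  \<comment> \<open>\<open>q\<close> is the largest sublinear functional below \<open>p\<close> that
    is at most \<open>- r\<close> on \<open>- A\<close>: subadditivity bounds any such functional at
    \<open>x\<close> by \<open>p (x + t *\<^sub>R a) - t * r\<close>.\<close>
  define \<phi> where "\<phi> x = (\<lambda>(t, a). p (x + t *\<^sub>R a) - t * r)" for x
  define q where "q x = Inf (\<phi> x ` ({0..} \<times> A))" for x
  have lb: "- p (- x) \<le> p (x + t *\<^sub>R a) - t * r" if "0 \<le> t" "a \<in> A" for x a t
  proof -
    have "t * r \<le> p (t *\<^sub>R a)"
      using that r by (simp add: sublinearD[OF p] mult_left_mono)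
    also have "\<dots> \<le> p (x + t *\<^sub>R a) + p (- x)"
      using sublinearD(1)[OF p, of "x + t *\<^sub>R a" "- x"] by simp
    finally show ?thesis by simp
  qed
  have bdd: "bdd_below (\<phi> x ` ({0..} \<times> A))" for x
    by (rule bdd_belowI[of _ "- p (- x)"]) (auto simp: \<phi>_def lb)
  have le: "q x \<le> p (x + t *\<^sub>R a) - t * r" if "0 \<le> t" "a \<in> A" for x a t
    unfolding q_def by (rule cInf_lower2[OF _ _ bdd, of "\<phi> x (t, a)"]) (use that in \<open>auto simp: \<phi>_def\<close>)
  have ge: "m \<le> q x" if "\<And>t a. 0 \<le> t \<Longrightarrow> a \<in> A \<Longrightarrow> m \<le> p (x + t *\<^sub>R a) - t * r" for m x
    unfolding q_def
  proof (rule cInf_greatest)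
    show "\<phi> x ` ({0..} \<times> A) \<noteq> {}" using A by auto
    show "m \<le> y" if "y \<in> \<phi> x ` ({0..} \<times> A)" for y
      using that \<open>\<And>t a. 0 \<le> t \<Longrightarrow> a \<in> A \<Longrightarrow> m \<le> p (x + t *\<^sub>R a) - t * r\<close> by (auto simp: \<phi>_def)
  qed
  obtain a0 where a0: "a0 \<in> A" using A by auto
  have qp: "q x \<le> p x" for x using le[of 0 a0 x] a0 by simp
  have add: "q (x + y) \<le> q x + q y" for x y
  proof -
    have "q (x + y) \<le> (p (x + t *\<^sub>R a) - t * r) + (p (y + s *\<^sub>R b) - s * r)"
      if "0 \<le> t" "a \<in> A" "0 \<le> s" "b \<in> A" for t a s b
    proof (cases "t + s = 0")
      case True
      then have "t = 0" "s = 0" using that by auto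
      then show ?thesis using qp[of "x + y"] sublinearD(1)[OF p, of x y] by simp
    next
      case False
      then have pos: "0 < t + s" using that by auto
      \<comment> \<open>Convexity of \<open>A\<close> merges the translations by
        \<open>t *\<^sub>R a\<close> and \<open>s *\<^sub>R b\<close> into the single one by
        \<open>(t + s) *\<^sub>R c\<close>.\<close>
      define c where "c = (t / (t + s)) *\<^sub>R a + (s / (t + s)) *\<^sub>R b"
      have "c \<in> A" unfolding c_def
        by (rule convexD[OF A(1)]) (use that pos in \<open>auto simp flip: add_divide_distrib\<close>)
      have "(t + s) *\<^sub>R c = t *\<^sub>R a + s *\<^sub>R b"
        using pos by (simp add: c_def scaleR_add_right)
      then have eq: "x + y + (t + s) *\<^sub>R c = (x + t *\<^sub>R a) + (y + s *\<^sub>R b)" by simp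
      have "q (x + y) \<le> p (x + y + (t + s) *\<^sub>R c) - (t + s) * r"
        using le[of "t + s" c "x + y"] pos \<open>c \<in> A\<close> by simp
      also have "\<dots> \<le> (p (x + t *\<^sub>R a) - t * r) + (p (y + s *\<^sub>R b) - s * r)"
        unfolding eq using sublinearD(1)[OF p, of "x + t *\<^sub>R a" "y + s *\<^sub>R b"]
        by (simp add: algebra_simps)
      finally show ?thesis .
    qed
    note key = this
    have "q (x + y) - (p (x + t *\<^sub>R a) - t * r) \<le> q y" if "0 \<le> t" "a \<in> A" for t a
      using key[OF that] by (intro ge) (simp add: algebra_simps)
    then have "q (x + y) - q y \<le> q x"
      by (intro ge) (simp add: algebra_simps)
    then show ?thesis by simp
  qed
  have hom_le: "q (c *\<^sub>R x) \<le> c * q x" if "0 < c" for c x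
  proof -
    have "q (c *\<^sub>R x) / c \<le> q x"
    proof (rule ge)
      fix t a assume "0 \<le> (t::real)" "a \<in> A"
      then have "q (c *\<^sub>R x) \<le> p (c *\<^sub>R x + (c * t) *\<^sub>R a) - c * t * r"
        using le[of "c * t" a "c *\<^sub>R x"] that by simp
      also have "c *\<^sub>R x + (c * t) *\<^sub>R a = c *\<^sub>R (x + t *\<^sub>R a)"
        by (simp add: scaleR_add_right)
      also have "p (c *\<^sub>R (x + t *\<^sub>R a)) - c * t * r = c * (p (x + t *\<^sub>R a) - t * r)"
        using that sublinearD(2)[OF p, of c "x + t *\<^sub>R a"] by (simp add: right_diff_distrib)
      finally show "q (c *\<^sub>R x) / c \<le> p (x + t *\<^sub>R a) - t * r"
        using that by (simp add: divide_le_eq mult.commute)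
    qed
    then show ?thesis using that by (simp add: divide_le_eq mult.commute)
  qed
  from add hom_le have "sublinear q" by (rule sublinearI)
  moreover have "q (- a) \<le> - r" if "a \<in> A" for a
    using le[of 1 a "- a"] that sublinearD(4)[OF p] by simp
  ultimately show ?thesis using qp by blast
qed

text \<open>A minimal sublinear functional below \<open>p\<close> is linear, because \<open>sublinear_decrease\<close>
  applied to a singleton cannot decrease it.\<close>

lemma linear_below_sublinear:
  fixes p :: "'a::real_vector \<Rightarrow> real"
  assumes p: "sublinear p"
  shows "\<exists>f. linear f \<and> (\<forall>x. f x \<le> p x)"
proof -
  define Q where "Q = {q. sublinear q \<and> q \<le> p}"
  \<comment> \<open>The order is reversed, so Zorn's lemma yields a minimal functional, and a chain
    is bounded by its pointwise infimum.\<close>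
  define P :: "('a \<Rightarrow> real) \<Rightarrow> _ \<Rightarrow> bool" where "P a b \<longleftrightarrow> b \<le> a" for a b
  have "\<exists>m\<in>Q. \<forall>a\<in>Q. P m a \<longrightarrow> a = m"
  proof (rule predicate_Zorn)
    show "partial_order_on Q (relation_of P Q)"
      by (rule partial_order_on_relation_ofI) (auto simp: P_def)
    fix C assume C: "C \<in> Chains (relation_of P Q)"
    then have CQ: "C \<subseteq> Q" by (rule Chains_relation_of)
    have chain: "a \<le> b \<or> b \<le> a" if "a \<in> C" "b \<in> C" for a b
      using C that by (auto simp: Chains_def relation_of_def P_def)
    show "\<exists>u\<in>Q. \<forall>a\<in>C. P a u"
    proof (cases "C = {}")
      case True
      then show ?thesis using p by (auto simp: Q_def)
    next
      case False
      define u where "u x = (INF q\<in>C. q x)" for x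
      have bdd: "bdd_below ((\<lambda>q. q x) ` C)" for x
      proof (rule bdd_belowI2)
        fix q assume "q \<in> C"
        then have "sublinear q" "q (- x) \<le> p (- x)" using CQ by (auto simp: Q_def le_fun_def)
        then show "- p (- x) \<le> q x" using sublinearD(3)[of q x] by linarith
      qed
      have le: "u x \<le> q x" if "q \<in> C" for q x
        unfolding u_def using bdd that by (rule cINF_lower)
      have ge: "m \<le> u x" if "\<And>q. q \<in> C \<Longrightarrow> m \<le> q x" for m x
        unfolding u_def using False that by (rule cINF_greatest)
      have subl: "sublinear q" if "q \<in> C" for q using that CQ by (auto simp: Q_def)
      have "u (x + y) \<le> u x + u y" for x y
      proof -
        have "u (x + y) \<le> q1 x + q2 y" if "q1 \<in> C" "q2 \<in> C" for q1 q2
        proof -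
          \<comment> \<open>Comparability in the chain gives one \<open>q\<close> below both, whose
            subadditivity passes to the infimum.\<close>
          obtain q where q: "q \<in> C" "q \<le> q1" "q \<le> q2" using chain \<open>q1 \<in> C\<close> \<open>q2 \<in> C\<close> by blast
          have "u (x + y) \<le> q x + q y"
            using le[OF q(1), of "x + y"] sublinearD(1)[OF subl[OF q(1)], of x y] by linarith
          also have "\<dots> \<le> q1 x + q2 y" using q by (auto simp: le_fun_def intro: add_mono)
          finally show ?thesis .
        qed
        note key = this
        have "u (x + y) - q1 x \<le> u y" if "q1 \<in> C" for q1
          using key[OF that] by (intro ge) (simp add: algebra_simps)
        then have "u (x + y) - u y \<le> u x" by (intro ge) (simp add: algebra_simps)
        then show ?thesis by simp
      qed
      moreover have "u (c *\<^sub>R x) \<le> c * u x" if "0 < c" for c x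
      proof -
        have "u (c *\<^sub>R x) / c \<le> u x"
        proof (rule ge)
          fix q assume "q \<in> C"
          then show "u (c *\<^sub>R x) / c \<le> q x"
            using le[of q "c *\<^sub>R x"] that subl
            by (simp add: sublinearD(2) divide_le_eq mult.commute)
        qed
        then show ?thesis using that by (simp add: divide_le_eq mult.commute)
      qed
      ultimately have "sublinear u" by (rule sublinearI)
      moreover have "u \<le> p"
      proof -
        obtain q where "q \<in> C" using False by auto
        then show ?thesis using le[of q] CQ by (auto simp: Q_def le_fun_def intro: order_trans)
      qed
      ultimately show ?thesis using le by (auto simp: Q_def P_def le_fun_def)
    qed
  qed
  then obtain m where m: "sublinear m" "m \<le> p" and min: "\<And>q. sublinear q \<Longrightarrow> q \<le> m \<Longrightarrow> q = m"
    unfolding Q_def P_def by (auto intro: order_trans)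
  have neg: "m (- y) = - m y" for y
  proof -
    obtain q where q: "sublinear q" "\<And>x. q x \<le> m x" "q (- y) \<le> - m y"
      using sublinear_decrease[OF m(1), of "{y}" "m y"] by auto
    then have "q = m" by (intro min) (auto simp: le_fun_def)
    with q(3) sublinearD(3)[OF m(1), of y] show ?thesis by simp
  qed
  have "linear m"
  proof (rule linearI)
    show "m (x + y) = m x + m y" for x y
      using sublinearD(1)[OF m(1), of x y] sublinearD(1)[OF m(1), of "- x" "- y"] neg[of x] neg[of y]
        neg[of "x + y"] by simp
    show "m (c *\<^sub>R x) = c *\<^sub>R m x" for c x
    proof (cases "0 \<le> c")
      case True
      then show ?thesis by (simp add: sublinearD(2)[OF m(1)])
    next
      case False
      then show ?thesis
        using sublinearD(2)[OF m(1), of "- c" x] neg[of "c *\<^sub>R x"] by simp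
    qed
  qed
  moreover have "m x \<le> p x" for x using m(2) by (simp add: le_fun_def)
  ultimately show ?thesis by blast
qed

section \<open>Brouwer's theorem in a cube of variable dimension\<close>

text \<open>The Hilbert cube is compact by Tychonoff's theorem and metrizable, hence sequentially
  compact.\<close>

lemma convergent_subseq_unit_cube:
  fixes x :: "nat \<Rightarrow> nat \<Rightarrow> real"
  assumes "\<And>k i. 0 \<le> x k i \<and> x k i \<le> 1"
  shows "\<exists>s l. strict_mono s \<and> (\<forall>i. (\<lambda>k. x (s k) i) \<longlonglongrightarrow> l i) \<and> (\<forall>i. 0 \<le> l i \<and> l i \<le> 1)"
proof -
  have "compactin euclidean (Pi\<^sub>E UNIV (\<lambda>_. {0..1}) :: (nat \<Rightarrow> real) set)"
    unfolding euclidean_product_topology[symmetric] compactin_PiE by simp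
  then have "compact (Pi\<^sub>E UNIV (\<lambda>_. {0..1}) :: (nat \<Rightarrow> real) set)" by simp
  then have "seq_compact (Pi\<^sub>E UNIV (\<lambda>_. {0..1}) :: (nat \<Rightarrow> real) set)"
    using compact_eq_seq_compact_metric by blast
  moreover have "\<forall>k. x k \<in> Pi\<^sub>E UNIV (\<lambda>_. {0..1})" using assms by auto
  ultimately obtain l s where l: "l \<in> Pi\<^sub>E UNIV (\<lambda>_. {0..1})" "strict_mono s" "(x \<circ> s) \<longlonglongrightarrow> l"
    by (rule seq_compactE)
  have "(\<lambda>k. x (s k) i) \<longlonglongrightarrow> l i" for i
  proof -
    have "isCont (\<lambda>f::nat \<Rightarrow> real. f i) l"
      using continuous_on_product_coordinates[of i] continuous_on_eq_continuous_at[OF open_UNIV] by blast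
    from isCont_tendsto_compose[OF this l(3)] show ?thesis by (simp add: o_def)
  qed
  moreover have "0 \<le> l i \<and> l i \<le> 1" for i using l(1) by auto
  ultimately show ?thesis using l(2) by blast
qed

text \<open>The dimension \<open>n\<close> is a term here, unlike in the library theorem \<open>brouwer\<close>.\<close>

lemma brouwer_unit_cube:
  fixes G :: "(nat \<Rightarrow> real) \<Rightarrow> nat \<Rightarrow> real"
  defines "Q \<equiv> {x. \<forall>i. 0 \<le> x i \<and> x i \<le> 1}"
  assumes G: "\<And>x i. x \<in> Q \<Longrightarrow> i < n \<Longrightarrow> 0 \<le> G x i \<and> G x i \<le> 1"
    and cont: "\<And>x l i. (\<And>k. x k \<in> Q) \<Longrightarrow> l \<in> Q \<Longrightarrow> (\<And>j. j < n \<Longrightarrow> (\<lambda>k. x k j) \<longlonglongrightarrow> l j) \<Longrightarrow> i < n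
      \<Longrightarrow> (\<lambda>k. G (x k) i) \<longlonglongrightarrow> G l i"
  shows "\<exists>x\<in>Q. \<forall>i<n. G x i = x i"
proof -
  \<comment> \<open>Grid points of mesh \<open>1 / p\<close>; coordinates from \<open>n\<close> on
    are set to 0 so that the point lies in \<open>Q\<close>.\<close>
  define sc where "sc p v = (\<lambda>i::nat. if i < n then real (v i) / real p else 0)" for p :: nat and v :: "nat \<Rightarrow> nat"
  have sc_Q: "sc p v \<in> Q" if "\<And>i. i < n \<Longrightarrow> v i \<le> p" "0 < p" for p v
    using that by (auto simp: sc_def Q_def)
  \<comment> \<open>\<open>q\<close> is the lower corner of a grid cube, and \<open>r\<close>,
    \<open>s\<close> are two of its vertices where the \<open>i\<close>-th displacement
    \<open>G x i - x i\<close> has opposite weak signs.\<close>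
  define cell where "cell p q i r s \<longleftrightarrow>
      (\<forall>j<n. q j \<le> r j \<and> r j \<le> q j + 1 \<and> q j \<le> s j \<and> s j \<le> q j + 1)
      \<and> sc p r i \<le> G (sc p r) i \<and> G (sc p s) i \<le> sc p s i" for p q i and r s :: "nat \<Rightarrow> nat"
  have "\<exists>q. (\<forall>i<n. q i < p) \<and> (\<forall>i<n. \<exists>r s. cell p q i r s)"
    if "0 < p" for p :: nat
  proof -
    \<comment> \<open>Kuhn's labelling by the sign of the displacement, overridden on the faces
      \<open>v i = 0\<close> and \<open>v i = p\<close> to meet the boundary conditions of
      \<open>kuhn_lemma\<close>. On these faces \<open>low\<close> and \<open>high\<close> hold
      because \<open>G\<close> takes values in the unit interval.\<close>
    define label :: "(nat \<Rightarrow> nat) \<Rightarrow> nat \<Rightarrow> nat" where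
      "label v i = (if v i = 0 then 0 else if v i = p \<or> G (sc p v) i < sc p v i then 1 else 0)" for v i
    have low: "sc p v i \<le> G (sc p v) i" if "label v i = 0" "i < n" "\<And>j. j < n \<Longrightarrow> v j \<le> p" for v i
    proof -
      have "v i = 0 \<or> sc p v i \<le> G (sc p v) i"
        using that(1) by (auto simp: label_def split: if_splits)
      then show ?thesis
      proof
        assume "v i = 0"
        then have "sc p v i = 0" by (simp add: sc_def)
        then show ?thesis using G[OF sc_Q[OF that(3) \<open>0 < p\<close>] that(2)] by simp
      qed
    qed
    have high: "G (sc p v) i \<le> sc p v i" if "label v i = 1" "i < n" "\<And>j. j < n \<Longrightarrow> v j \<le> p" for v i
    proof -
      have "v i = p \<or> G (sc p v) i \<le> sc p v i"
        using that(1) by (auto simp: label_def split: if_splits)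
      then show ?thesis
      proof
        assume "v i = p"
        then have "sc p v i = 1" using \<open>0 < p\<close> that(2) by (simp add: sc_def)
        then show ?thesis using G[OF sc_Q[OF that(3) \<open>0 < p\<close>] that(2)] by simp
      qed
    qed
    have "\<forall>x. (\<forall>i<n. x i \<le> p) \<longrightarrow> (\<forall>i<n. label x i = 0 \<or> label x i = 1)"
      "\<forall>x. (\<forall>i<n. x i \<le> p) \<longrightarrow> (\<forall>i<n. x i = 0 \<longrightarrow> label x i = 0)"
      "\<forall>x. (\<forall>i<n. x i \<le> p) \<longrightarrow> (\<forall>i<n. x i = p \<longrightarrow> label x i = 1)"
      using that by (auto simp: label_def)
    from kuhn_lemma[OF that this] obtain q where q: "\<forall>i<n. q i < p"
      and rs: "\<forall>i<n. \<exists>r s. (\<forall>j<n. q j \<le> r j \<and> r j \<le> q j + 1) \<and> (\<forall>j<n. q j \<le> s j \<and> s j \<le> q j + 1)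
        \<and> label r i \<noteq> label s i" by blast
    have "\<exists>r s. cell p q i r s" if i: "i < n" for i
    proof -
      obtain r s where r: "\<forall>j<n. q j \<le> r j \<and> r j \<le> q j + 1" and s: "\<forall>j<n. q j \<le> s j \<and> s j \<le> q j + 1"
        and ne: "label r i \<noteq> label s i" using rs i by blast
      have rp: "r j \<le> p" and sp: "s j \<le> p" if "j < n" for j
        using q r s that by (auto dest!: spec[of _ j])
      have "label r i = 0 \<and> label s i = 1 \<or> label s i = 0 \<and> label r i = 1"
        using ne \<open>0 < p\<close> by (auto simp: label_def split: if_splits)
      then show ?thesis
      proof
        assume "label r i = 0 \<and> label s i = 1"
        then show ?thesis unfolding cell_def using r s low[of r i] high[of s i] rp sp i by blast
      next
        assume "label s i = 0 \<and> label r i = 1"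
        then show ?thesis unfolding cell_def using r s low[of s i] high[of r i] rp sp i by blast
      qed
    qed
    then show ?thesis using q by blast
  qed
  then have "\<forall>p. \<exists>q. 0 < p \<longrightarrow> (\<forall>i<n. q i < p) \<and> (\<forall>i<n. \<exists>r s. cell p q i r s)"
    by blast
  then obtain q where q': "\<forall>p. 0 < p \<longrightarrow> (\<forall>i<n. q p i < p) \<and> (\<forall>i<n. \<exists>r s. cell p (q p) i r s)"
    unfolding choice_iff by (rule exE)
  then have q: "\<And>p i. 0 < p \<Longrightarrow> i < n \<Longrightarrow> q p i < p" by blast
  have "\<forall>p i. \<exists>r s. 0 < p \<longrightarrow> i < n \<longrightarrow> cell p (q p) i r s" using q' by blast
  then obtain r s where "\<forall>p i. 0 < p \<longrightarrow> i < n \<longrightarrow> cell p (q p) i (r p i) (s p i)"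
    unfolding choice_iff by (elim exE)
  then have rs: "\<And>p i j. 0 < p \<Longrightarrow> i < n \<Longrightarrow> j < n \<Longrightarrow>
        q p j \<le> r p i j \<and> r p i j \<le> q p j + 1 \<and> q p j \<le> s p i j \<and> s p i j \<le> q p j + 1"
    and r: "\<And>p i. 0 < p \<Longrightarrow> i < n \<Longrightarrow> sc p (r p i) i \<le> G (sc p (r p i)) i"
    and s: "\<And>p i. 0 < p \<Longrightarrow> i < n \<Longrightarrow> G (sc p (s p i)) i \<le> sc p (s p i) i"
    unfolding cell_def by blast+
  \<comment> \<open>Cells are provided only for \<open>0 < p\<close>, hence the mesh number
    \<open>Suc k\<close>.\<close>
  define x where "x k = sc (Suc k) (q (Suc k))" for k
  have "x k \<in> Q" for k unfolding x_def by (rule sc_Q) (use q in \<open>auto simp: less_imp_le\<close>)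
  then have x01: "0 \<le> x k i \<and> x k i \<le> 1" for k i by (auto simp: Q_def)
  obtain \<sigma> l where \<sigma>: "strict_mono \<sigma>" and lim: "\<And>i. (\<lambda>k. x (\<sigma> k) i) \<longlonglongrightarrow> l i"
    and l: "\<And>i. 0 \<le> l i \<and> l i \<le> 1"
    using convergent_subseq_unit_cube[of x, OF x01] by blast
  have lQ: "l \<in> Q" using l by (simp add: Q_def)
  have small: "(\<lambda>k. 1 / real (Suc (\<sigma> k))) \<longlonglongrightarrow> 0"
    using LIMSEQ_subseq_LIMSEQ[OF LIMSEQ_inverse_real_of_nat \<sigma>] by (simp add: o_def inverse_eq_divide)
  \<comment> \<open>A vertex exceeds the lower corner of its cell by at most one mesh width per
    coordinate, so both have the same limit.\<close>
  have near: "(\<lambda>k. sc (Suc (\<sigma> k)) (v (\<sigma> k)) j) \<longlonglongrightarrow> l j"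
    if v: "\<And>k. q (Suc k) j \<le> v k j \<and> v k j \<le> q (Suc k) j + 1" and "j < n" for v j
  proof (rule tendsto_sandwich[OF _ _ lim[of j]])
    show "\<forall>\<^sub>F k in sequentially. x (\<sigma> k) j \<le> sc (Suc (\<sigma> k)) (v (\<sigma> k)) j"
      using v \<open>j < n\<close> by (auto simp: x_def sc_def divide_right_mono)
    show "\<forall>\<^sub>F k in sequentially. sc (Suc (\<sigma> k)) (v (\<sigma> k)) j \<le> x (\<sigma> k) j + 1 / real (Suc (\<sigma> k))"
    proof (rule always_eventually, rule allI)
      fix k
      have "real (v (\<sigma> k) j) \<le> real (q (Suc (\<sigma> k)) j) + 1" using v[of "\<sigma> k"] by linarith
      then have "real (v (\<sigma> k) j) / real (Suc (\<sigma> k)) \<le> (real (q (Suc (\<sigma> k)) j) + 1) / real (Suc (\<sigma> k))"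
        by (rule divide_right_mono) simp
      then show "sc (Suc (\<sigma> k)) (v (\<sigma> k)) j \<le> x (\<sigma> k) j + 1 / real (Suc (\<sigma> k))"
        using \<open>j < n\<close> by (simp add: x_def sc_def add_divide_distrib)
    qed
    show "(\<lambda>k. x (\<sigma> k) j + 1 / real (Suc (\<sigma> k))) \<longlonglongrightarrow> l j"
      using tendsto_add[OF lim[of j] small] by simp
  qed
  \<comment> \<open>The vertices \<open>r\<close> and \<open>s\<close> depend on \<open>i\<close>,
    but all converge to the same \<open>l\<close>; each of the two sign conditions yields one
    inequality in the limit.\<close>
  have "G l i = l i" if i: "i < n" for i
  proof (rule antisym)
    have rl: "(\<lambda>k. sc (Suc (\<sigma> k)) (r (Suc (\<sigma> k)) i) j) \<longlonglongrightarrow> l j" if "j < n" for j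
      by (rule near[where v = "\<lambda>k. r (Suc k) i"]) (use rs[OF _ i that] that in auto)
    have sl: "(\<lambda>k. sc (Suc (\<sigma> k)) (s (Suc (\<sigma> k)) i) j) \<longlonglongrightarrow> l j" if "j < n" for j
      by (rule near[where v = "\<lambda>k. s (Suc k) i"]) (use rs[OF _ i that] that in auto)
    have rQ: "sc (Suc k) (r (Suc k) i) \<in> Q" and sQ: "sc (Suc k) (s (Suc k) i) \<in> Q" for k
    proof -
      have "r (Suc k) i j \<le> Suc k \<and> s (Suc k) i j \<le> Suc k" if "j < n" for j
        using rs[OF _ i that, of "Suc k"] q[OF _ that, of "Suc k"] by simp
      then show "sc (Suc k) (r (Suc k) i) \<in> Q" "sc (Suc k) (s (Suc k) i) \<in> Q"
        by (auto intro!: sc_Q)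
    qed
    have "(\<lambda>k. G (sc (Suc (\<sigma> k)) (r (Suc (\<sigma> k)) i)) i) \<longlonglongrightarrow> G l i"
      using rQ lQ rl i by (rule cont)
    then show "l i \<le> G l i"
      by (rule LIMSEQ_le[OF rl[OF i]]) (use r i in auto)
    have "(\<lambda>k. G (sc (Suc (\<sigma> k)) (s (Suc (\<sigma> k)) i)) i) \<longlonglongrightarrow> G l i"
      using sQ lQ sl i by (rule cont)
    then show "G l i \<le> l i"
      by (rule LIMSEQ_le[OF _ sl[OF i]]) (use s i in auto)
  qed
  with lQ show ?thesis by blast
qed

section \<open>Averages over a compact set\<close>

text \<open>Tychonoff's theorem again. With \<open>'b\<close> a type of sets the cube need not be
  metrizable, so a filter \<open>F\<close> takes the place of a subsequence.\<close>

lemma set_function_cluster_point: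
  fixes \<mu> :: "nat \<Rightarrow> 'b \<Rightarrow> real"
  assumes "\<And>k B. 0 \<le> \<mu> k B \<and> \<mu> k B \<le> 1"
  shows "\<exists>\<nu> F. F \<noteq> bot \<and> F \<le> filtermap \<mu> sequentially \<and> (\<forall>B. ((\<lambda>m. m B) \<longlongrightarrow> \<nu> B) F)"
proof -
  have "compactin euclidean (Pi\<^sub>E UNIV (\<lambda>_. {0..1}) :: ('b \<Rightarrow> real) set)"
    unfolding euclidean_product_topology[symmetric] compactin_PiE by simp
  then have cpt: "compact (Pi\<^sub>E UNIV (\<lambda>_. {0..1}) :: ('b \<Rightarrow> real) set)" by simp
  have "filtermap \<mu> sequentially \<noteq> bot" by (simp add: filtermap_bot_iff)
  moreover have "eventually (\<lambda>m. m \<in> Pi\<^sub>E UNIV (\<lambda>_. {0..1})) (filtermap \<mu> sequentially)"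
    using assms by (simp add: eventually_filtermap PiE_iff)
  ultimately obtain \<nu> where \<nu>: "inf (nhds \<nu>) (filtermap \<mu> sequentially) \<noteq> bot"
    using cpt unfolding compact_filter by meson
  have "((\<lambda>m. m B) \<longlongrightarrow> \<nu> B) (inf (nhds \<nu>) (filtermap \<mu> sequentially))" for B
  proof -
    have "((\<lambda>f::'b \<Rightarrow> real. f B) \<longlongrightarrow> \<nu> B) (nhds \<nu>)"
    proof -
      have "continuous_on UNIV (\<lambda>f::'b \<Rightarrow> real. f B)" by simp
      then show ?thesis
        unfolding continuous_on_def
        by (intro tendsto_at_iff_tendsto_nhds[of "\<lambda>f. f B" \<nu>, THEN iffD1]) blast
    qed
    then show ?thesis by (rule filterlim_mono) auto
  qed
  moreover have "inf (nhds \<nu>) (filtermap \<mu> sequentially) \<le> filtermap \<mu> sequentially"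
    by simp
  ultimately show ?thesis using \<nu> by blast
qed

text \<open>The \<open>\<mu> k\<close> cluster at a finitely additive \<open>\<nu>\<close> with \<open>\<nu> (A n) \<ge> \<delta>\<close>. Finite unions
  \<open>E j\<close> of the sets \<open>A j, A (j + 1), \<dots>\<close> exhaust the \<open>\<nu>\<close>-content of the tail up to \<open>\<delta> / 2 ^ (j + 2)\<close>,
  so the closed sets \<open>E j\<close> have the finite intersection property.\<close>

lemma compact_common_point:
  fixes \<mu> :: "nat \<Rightarrow> 'a set \<Rightarrow> real" and A :: "nat \<Rightarrow> 'a set"
  assumes C: "compactin X C" and A: "\<And>n. closedin X (A n)" "\<And>n. A n \<subseteq> C"
    and bounds: "\<And>k B. 0 \<le> \<mu> k B \<and> \<mu> k B \<le> 1"
    and additive: "\<And>k B D. B \<inter> D = {} \<Longrightarrow> \<mu> k (B \<union> D) = \<mu> k B + \<mu> k D"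
    and "0 < \<delta>" and large: "\<And>n. \<forall>\<^sub>F k in sequentially. \<delta> \<le> \<mu> k (A n)"
  shows "\<exists>c\<in>C. \<forall>j. \<exists>n\<ge>j. c \<in> A n"
proof -
  obtain \<nu> F where F: "F \<noteq> bot" "F \<le> filtermap \<mu> sequentially" and lim: "\<And>B. ((\<lambda>m. m B) \<longlongrightarrow> \<nu> B) F"
    using set_function_cluster_point[of \<mu>, OF bounds] by blast
  have ev: "eventually P F" if "\<forall>\<^sub>F k in sequentially. P (\<mu> k)" for P
    using F(2) that by (simp add: le_filter_def eventually_filtermap)
  have add: "\<nu> (B \<union> D) = \<nu> B + \<nu> D" if "B \<inter> D = {}" for B D
  proof (rule tendsto_unique[OF F(1) lim])
    have "\<forall>\<^sub>F m in F. m B + m D = m (B \<union> D)"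
      by (rule ev) (simp add: additive[OF that])
    with tendsto_add[OF lim[of B] lim[of D]] show "((\<lambda>m. m (B \<union> D)) \<longlongrightarrow> \<nu> B + \<nu> D) F"
      by (rule Lim_transform_eventually)
  qed
  have pos: "0 \<le> \<nu> B" for B
    by (rule tendsto_lowerbound[OF lim ev F(1)]) (simp add: bounds)
  have le1: "\<nu> B \<le> 1" for B
    by (rule tendsto_upperbound[OF lim ev F(1)]) (simp add: bounds)
  have \<nu>A: "\<delta> \<le> \<nu> (A n)" for n
    by (rule tendsto_lowerbound[OF lim ev F(1)]) (rule large)
  have split: "\<nu> B = \<nu> (B \<inter> D) + \<nu> (B - D)" for B D
  proof -
    have "(B \<inter> D) \<inter> (B - D) = {}" by auto
    from add[OF this] show ?thesis by (simp add: Int_Diff_Un)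
  qed
  have mono: "\<nu> B \<le> \<nu> D" if "B \<subseteq> D" for B D
    using split[of D B] pos[of "D - B"] that by (simp add: Int_absorb1)
  have null: "\<nu> {} = 0" using add[of "{}" "{}"] by simp
  have "\<exists>m. \<forall>n\<ge>j. \<nu> (A n - (\<Union>i\<in>{j..m}. A i)) \<le> \<delta> / 2 ^ (j + 2)" for j
  proof -
    \<comment> \<open>The contents of the growing unions are bounded by 1, so some finite union
      comes within \<open>\<delta> / 2 ^ (j + 2)\<close> of their supremum; a further
      \<open>A n\<close> can then add at most that much.\<close>
    define t where "t = (SUP m. \<nu> (\<Union>i\<in>{j..m}. A i))"
    have bdd: "bdd_above (range (\<lambda>m. \<nu> (\<Union>i\<in>{j..m}. A i)))"
      by (rule bdd_aboveI2[OF le1])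
    have "t - \<delta> / 2 ^ (j + 2) < t" using \<open>0 < \<delta>\<close> by simp
    then obtain m where m: "t - \<delta> / 2 ^ (j + 2) < \<nu> (\<Union>i\<in>{j..m}. A i)"
      unfolding t_def less_cSUP_iff[OF UNIV_not_empty bdd] by blast
    have "\<nu> (A n - (\<Union>i\<in>{j..m}. A i)) \<le> \<delta> / 2 ^ (j + 2)" if "j \<le> n" for n
    proof -
      let ?U = "\<Union>i\<in>{j..m}. A i"
      have "\<nu> ?U + \<nu> (A n - ?U) = \<nu> (?U \<union> (A n - ?U))" by (rule add[symmetric]) auto
      also have "\<dots> \<le> \<nu> (\<Union>i\<in>{j..max m n}. A i)"
        by (rule mono) (use that in \<open>auto simp: le_max_iff_disj\<close>)
      also have "\<dots> \<le> t" unfolding t_def by (rule cSUP_upper[OF UNIV_I bdd])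
      finally show ?thesis using m by simp
    qed
    then show ?thesis by blast
  qed
  then obtain m where m: "\<And>j n. j \<le> n \<Longrightarrow> \<nu> (A n - (\<Union>i\<in>{j..m j}. A i)) \<le> \<delta> / 2 ^ (j + 2)"
    by metis
  define E where "E j = (\<Union>i\<in>{j..m j}. A i)" for j
  \<comment> \<open>Intersecting with the \<open>E j\<close> one after another loses at most the
    content of \<open>B - E j\<close> each time.\<close>
  have sum: "\<nu> B \<le> \<nu> (B \<inter> (\<Inter>j<J. E j)) + (\<Sum>j<J. \<nu> (B - E j))" for B J
  proof (induction J)
    case (Suc J)
    have "\<nu> (B \<inter> (\<Inter>j<J. E j)) = \<nu> ((B \<inter> (\<Inter>j<J. E j)) \<inter> E J) + \<nu> ((B \<inter> (\<Inter>j<J. E j)) - E J)"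
      by (rule split)
    also have "(B \<inter> (\<Inter>j<J. E j)) \<inter> E J = B \<inter> (\<Inter>j<Suc J. E j)"
      by (auto simp: less_Suc_eq)
    also have "\<nu> ((B \<inter> (\<Inter>j<J. E j)) - E J) \<le> \<nu> (B - E J)" by (rule mono) auto
    finally show ?case using Suc by simp
  qed simp
  \<comment> \<open>\<open>A J\<close> is tested because the tail bound of every
    \<open>j < J\<close> applies to it. The losses sum to
    \<open>\<delta> / 2 * (1 - 1 / 2 ^ J)\<close>, less than its content, which is at least
    \<open>\<delta>\<close>.\<close>
  have nonempty: "C \<inter> (\<Inter>j<J. E j) \<noteq> {}" for J
  proof
    assume empty: "C \<inter> (\<Inter>j<J. E j) = {}"
    have "\<delta> \<le> \<nu> (A J)" by (rule \<nu>A)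
    also have "\<dots> \<le> \<nu> (A J \<inter> (\<Inter>j<J. E j)) + (\<Sum>j<J. \<nu> (A J - E j))" by (rule sum)
    also have "A J \<inter> (\<Inter>j<J. E j) = {}" using empty A(2) by blast
    also have "\<nu> {} + (\<Sum>j<J. \<nu> (A J - E j)) \<le> 0 + (\<Sum>j<J. \<delta> / 2 ^ (j + 2))"
      unfolding E_def by (intro add_mono sum_mono m) (simp_all add: null)
    also have "(\<Sum>j<J. \<delta> / 2 ^ (j + 2)) = \<delta> / 2 * (1 - 1 / 2 ^ J)"
      by (induction J) (simp_all add: field_simps)
    also have "0 + \<delta> / 2 * (1 - 1 / 2 ^ J) \<le> \<delta> / 2 * 1"
      using \<open>0 < \<delta>\<close> by (simp del: mult_1_right)
    finally show False using \<open>0 < \<delta>\<close> by simp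
  qed
  have "C \<inter> \<Inter>(range E) \<noteq> {}"
  proof -
    have "\<forall>D\<in>range E. closedin X D"
      unfolding E_def using A(1) by (auto intro!: closedin_Union)
    moreover have "C \<inter> \<Inter>\<F> \<noteq> {}" if fin: "finite \<F>" "\<F> \<subseteq> range E" for \<F>
    proof -
      obtain I where I: "finite I" "\<F> = E ` I"
        using finite_subset_image[OF fin] by blast
      then obtain J where "\<forall>i\<in>I. i < J"
        using finite_nat_set_iff_bounded by blast
      then have "C \<inter> (\<Inter>j<J. E j) \<subseteq> C \<inter> \<Inter>\<F>" using I by blast
      then show ?thesis using nonempty[of J] by blast
    qed
    ultimately show ?thesis
      using C[unfolded compactin_fip, THEN conjunct2, THEN spec, of "range E"] by blast
  qed
  then obtain c where c: "c \<in> C" "\<And>j. c \<in> E j" by blast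
  have "\<exists>n\<ge>j. c \<in> A n" for j using c(2)[of j] by (auto simp: E_def)
  with c(1) show ?thesis by blast
qed

text \<open>Stands in for dominated convergence with respect to a limit measure, as in the proof of
  Krein's theorem.\<close>

lemma averages_of_null_sequence:
  fixes h :: "nat \<Rightarrow> 'a \<Rightarrow> real" and V :: "nat \<Rightarrow> 'a set" and w :: "nat \<Rightarrow> 'a \<Rightarrow> real"
  assumes C: "compactin X C" and closed: "\<And>n e. closedin X {c \<in> C. e \<le> \<bar>h n c\<bar>}"
    and bounded: "\<And>n c. c \<in> C \<Longrightarrow> \<bar>h n c\<bar> \<le> M"
    and null: "\<And>c. c \<in> C \<Longrightarrow> (\<lambda>n. h n c) \<longlonglongrightarrow> 0"
    and V: "\<And>k. finite (V k)" "\<And>k. V k \<subseteq> C"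
    and w: "\<And>k c. c \<in> V k \<Longrightarrow> 0 \<le> w k c" "\<And>k. (\<Sum>c\<in>V k. w k c) = 1"
    and "0 < e"
  shows "\<exists>n. \<not> (\<forall>\<^sub>F k in sequentially. e \<le> \<bar>\<Sum>c\<in>V k. w k c * h n c\<bar>)"
proof (rule ccontr)
  assume "\<not> ?thesis"
  then have large: "\<forall>\<^sub>F k in sequentially. e \<le> \<bar>\<Sum>c\<in>V k. w k c * h n c\<bar>" for n by blast
  \<comment> \<open>The weights are read as a finitely additive probability on all sets, to which
    \<open>compact_common_point\<close> applies.\<close>
  define \<mu> where "\<mu> k B = (\<Sum>c\<in>V k \<inter> B. w k c)" for k B
  define A where "A n = {c \<in> C. e / 2 \<le> \<bar>h n c\<bar>}" for n
  have "V 0 \<noteq> {}" using w(2)[of 0] by auto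
  then obtain c0 where "c0 \<in> C" using V(2)[of 0] by auto
  then have M: "0 \<le> M" using bounded[of c0 0] by linarith
  \<comment> \<open>The bound \<open>M\<close> is used on \<open>A n\<close> and
    \<open>e / 2\<close> off it, so an average of size \<open>e\<close> forces mass onto
    \<open>A n\<close>.\<close>
  have avg: "\<bar>\<Sum>c\<in>V k. w k c * h n c\<bar> \<le> M * \<mu> k (A n) + e / 2" for k n
  proof -
    have "\<bar>\<Sum>c\<in>V k. w k c * h n c\<bar> \<le> (\<Sum>c\<in>V k. w k c * \<bar>h n c\<bar>)"
      using w(1) by (intro order_trans[OF sum_abs] sum_mono) (simp add: abs_mult)
    also have "\<dots> \<le> (\<Sum>c\<in>V k. (if c \<in> A n then M * w k c else 0) + e / 2 * w k c)"
    proof (rule sum_mono)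
      fix c assume c: "c \<in> V k"
      then have "c \<in> C" "0 \<le> w k c" using V w by auto
      show "w k c * \<bar>h n c\<bar> \<le> (if c \<in> A n then M * w k c else 0) + e / 2 * w k c"
      proof (cases "c \<in> A n")
        case True
        have "w k c * \<bar>h n c\<bar> \<le> w k c * M"
          using bounded \<open>c \<in> C\<close> \<open>0 \<le> w k c\<close> by (intro mult_left_mono)
        moreover have "0 \<le> e / 2 * w k c" using \<open>0 < e\<close> \<open>0 \<le> w k c\<close> by simp
        ultimately show ?thesis using True by (simp add: mult.commute)
      next
        case False
        then have "\<bar>h n c\<bar> \<le> e / 2" using \<open>c \<in> C\<close> by (simp add: A_def)
        then have "w k c * \<bar>h n c\<bar> \<le> w k c * (e / 2)"
          using \<open>0 \<le> w k c\<close> by (intro mult_left_mono)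
        then show ?thesis using False by (simp add: mult.commute)
      qed
    qed
    also have "\<dots> = (\<Sum>c\<in>V k. if c \<in> A n then M * w k c else 0) + e / 2"
      by (simp only: sum.distrib sum_distrib_left[symmetric] w(2) mult_1_right)
    also have "(\<Sum>c\<in>V k. if c \<in> A n then M * w k c else 0) = M * \<mu> k (A n)"
      unfolding \<mu>_def sum_distrib_left sum.inter_restrict[OF V(1)] by (rule sum.cong) auto
    finally show ?thesis .
  qed
  have bounds: "0 \<le> \<mu> k B \<and> \<mu> k B \<le> 1" for k B
  proof
    show "0 \<le> \<mu> k B" unfolding \<mu>_def by (rule sum_nonneg) (use w in auto)
    have "\<mu> k B \<le> (\<Sum>c\<in>V k. w k c)"
      unfolding \<mu>_def by (rule sum_mono2) (use V w in auto)
    then show "\<mu> k B \<le> 1" by (simp add: w)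
  qed
  have additive: "\<mu> k (B \<union> D) = \<mu> k B + \<mu> k D" if "B \<inter> D = {}" for k B D
  proof -
    have "V k \<inter> (B \<union> D) = (V k \<inter> B) \<union> (V k \<inter> D)" by auto
    then show ?thesis
      unfolding \<mu>_def using V(1) that by (simp add: sum.union_disjoint disjoint_iff)
  qed
  \<comment> \<open>Solving \<open>e / 2 <= M * \<mu> k (A n)\<close> would divide by
    \<open>2 * M\<close>; the extra 1 covers \<open>M = 0\<close>.\<close>
  have pos: "0 < e / (2 * M + 1)" using \<open>0 < e\<close> M by simp
  have AX: "closedin X (A n)" and AC: "A n \<subseteq> C" for n
    unfolding A_def by (rule closed) auto
  have \<mu>A: "\<forall>\<^sub>F k in sequentially. e / (2 * M + 1) \<le> \<mu> k (A n)" for n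
    using large[of n]
  proof eventually_elim
    case (elim k)
    then have "e / 2 \<le> M * \<mu> k (A n)" using avg[of k n] by linarith
    also have "\<dots> \<le> (M + 1 / 2) * \<mu> k (A n)"
      using bounds[of k "A n"] by (intro mult_right_mono) auto
    finally show ?case using M by (simp add: field_simps)
  qed
  have "\<exists>c\<in>C. \<forall>j. \<exists>n\<ge>j. c \<in> A n"
    by (rule compact_common_point[where X = X and C = C and A = A and \<mu> = \<mu>, OF C AX AC bounds additive pos \<mu>A])
  \<comment> \<open>Such a \<open>c\<close> lies in infinitely many \<open>A n\<close>, against the
    convergence of \<open>h n c\<close> to 0.\<close>
  then obtain c where c: "c \<in> C" "\<And>j. \<exists>n\<ge>j. c \<in> A n" by blast
  have "\<forall>\<^sub>F n in sequentially. \<bar>h n c\<bar> < e / 2"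
    using tendstoD[OF null[OF c(1)], of "e / 2"] \<open>0 < e\<close> by (simp add: dist_norm)
  then obtain j where "\<And>n. j \<le> n \<Longrightarrow> \<bar>h n c\<bar> < e / 2"
    unfolding eventually_sequentially by blast
  with c(2)[of j] show False by (force simp: A_def)
qed

section \<open>Duality in generalized normed spaces\<close>

lemma weakly_sequentially_continuous_onD:
  assumes "weakly_sequentially_continuous_on N S T" and "\<And>k. x k \<in> S" and "l \<in> S"
    and "limitin (weak_topology N) x l sequentially"
  shows "limitin (weak_topology N) (\<lambda>k. T (x k)) (T l) sequentially"
  using assms by (simp add: weakly_sequentially_continuous_on_def)

lemma weakly_sequentially_continuous_on_subset:
  assumes "weakly_sequentially_continuous_on N S T" and "K \<subseteq> S"
  shows "weakly_sequentially_continuous_on N K T"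
  unfolding weakly_sequentially_continuous_on_def
proof (intro allI impI, elim conjE)
  fix x l
  assume x: "\<forall>k. x k \<in> K" "l \<in> K" and lim: "limitin (weak_topology N) x l sequentially"
  have "x k \<in> S" "l \<in> S" for k using x assms(2) by blast+
  then show "limitin (weak_topology N) (\<lambda>k. T (x k)) (T l) sequentially"
    using lim by (rule weakly_sequentially_continuous_onD[OF assms(1)])
qed

text \<open>The set is built in countably many stages. Rational weights keep each stage countable,
  and two points lie in a common stage because the stages increase.\<close>

lemma countable_invariant_rational_convex:
  fixes T :: "'a::real_vector \<Rightarrow> 'a"
  assumes "x0 \<in> S" and "convex S" and T: "T ` S \<subseteq> S"
  shows "\<exists>D. countable D \<and> x0 \<in> D \<and> D \<subseteq> S \<and> T ` D \<subseteq> D \<and>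
    (\<forall>a\<in>D. \<forall>b\<in>D. \<forall>q\<in>\<rat> \<inter> {0..1}. (1 - q) *\<^sub>R a + q *\<^sub>R b \<in> D)"
proof -
  define step where "step A = A \<union> T ` A \<union> (\<lambda>(q, a, b). (1 - q) *\<^sub>R a + q *\<^sub>R b) ` ((\<rat> \<inter> {0..1}) \<times> A \<times> A)"
    for A :: "'a set"
  define D where "D n = (step ^^ n) {x0}" for n
  have D_Suc: "D (Suc n) = step (D n)" for n by (simp add: D_def)
  have cnt: "countable (D n)" for n
  proof (induction n)
    case (Suc n)
    then show ?case
      unfolding D_Suc step_def
      by (intro countable_Un countable_image countable_SIGMA countable_Int1 countable_rat)
  qed (simp add: D_def)
  have sub: "D n \<subseteq> S" for n
  proof (induction n)
    case (Suc n)
    then show ?case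
      unfolding D_Suc step_def using T by (auto intro!: convexD_alt[OF \<open>convex S\<close>])
  qed (simp add: D_def assms)
  have mono: "D m \<subseteq> D n" if "m \<le> n" for m n
    using that by (rule lift_Suc_mono_le[rotated]) (auto simp: D_Suc step_def)
  have conv: "(1 - q) *\<^sub>R a + q *\<^sub>R b \<in> (\<Union>n. D n)" if ab: "a \<in> (\<Union>n. D n)" "b \<in> (\<Union>n. D n)" "q \<in> \<rat> \<inter> {0..1}" for a b q
  proof -
    obtain m n where "a \<in> D m" "b \<in> D n" using ab by blast
    then have "a \<in> D (max m n)" "b \<in> D (max m n)"
      using mono[of m "max m n"] mono[of n "max m n"] by auto
    then have "(1 - q) *\<^sub>R a + q *\<^sub>R b \<in> D (Suc (max m n))"
      using ab(3) unfolding D_Suc step_def by force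
    then show ?thesis by blast
  qed
  have inv: "T a \<in> (\<Union>n. D n)" if a: "a \<in> (\<Union>n. D n)" for a
  proof -
    obtain n where "a \<in> D n" using a by blast
    then have "T a \<in> D (Suc n)" by (simp add: D_Suc step_def)
    then show ?thesis by blast
  qed
  have "x0 \<in> D 0" by (simp add: D_def)
  then have "x0 \<in> (\<Union>n. D n)" by blast
  moreover have "countable (\<Union>n. D n)" using cnt by simp
  moreover have "(\<Union>n. D n) \<subseteq> S" using sub by blast
  moreover have "T ` (\<Union>n. D n) \<subseteq> (\<Union>n. D n)" using inv by (rule image_subsetI)
  ultimately show ?thesis using conv by (intro exI[of _ "\<Union>n. D n"] conjI ballI)
qed

section \<open>The scalar norm, its dual and weak limits\<close>

context generalized_normed_space
begin

interpretation M: Metric_space UNIV "gdist N"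
  by (rule Metric_space_gdist)

text \<open>The max norm, which induces \<open>gtopology N\<close> and reduces the topological
  arguments to those of an ordinary normed space.\<close>

definition nrm :: "'a \<Rightarrow> real"
  where "nrm x = gdist N x 0"

lemma gdist_nrm: "gdist N x y = nrm (x - y)"
  by (simp add: nrm_def gdist_def)

lemma nrm_nonneg [simp]: "0 \<le> nrm x"
  by (simp add: nrm_def)

lemma nrm_eq_zero_iff [simp]: "nrm x = 0 \<longleftrightarrow> x = 0"
  by (simp add: nrm_def)

lemma nrm_zero [simp]: "nrm 0 = 0"
  by simp

lemma nrm_scaleR: "nrm (c *\<^sub>R x) = \<bar>c\<bar> * nrm x"
proof -
  have "mono (\<lambda>t. \<bar>c\<bar> * t)" by (simp add: monoI mult_left_mono)
  then have "\<bar>c\<bar> * (MAX i. N x $ i) = Max ((\<lambda>t. \<bar>c\<bar> * t) ` range (\<lambda>i. N x $ i))"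
    by (rule mono_Max_commute) auto
  then show ?thesis by (simp add: nrm_def gdist_def N_scaleR image_image)
qed

lemma nrm_triangle: "nrm (x + y) \<le> nrm x + nrm y"
  using M.triangle[of x 0 "- y"] M.commute[of 0 "- y"] nrm_scaleR[of "-1" y] by (simp add: gdist_nrm)

lemma nrm_minus: "nrm (- x) = nrm x"
  using nrm_scaleR[of "-1" x] by simp

lemma in_closure_of: "x \<in> gtopology N closure_of S \<longleftrightarrow> (\<forall>e>0. \<exists>y\<in>S. nrm (x - y) < e)"
  unfolding gtopology_def M.metric_closure_of by (simp add: gdist_nrm)

definition dual :: "('a \<Rightarrow> real) set"
  where "dual = {f. linear f \<and> continuous_map (gtopology N) euclideanreal f}"

lemma dual_iff: "f \<in> dual \<longleftrightarrow> linear f \<and> (\<exists>M. \<forall>x. \<bar>f x\<bar> \<le> M * nrm x)"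
proof (cases "linear f")
  case f: True
  show ?thesis
  proof
    assume "f \<in> dual"
    then have "continuous_map (gtopology N) euclideanreal f" by (simp add: dual_def)
    then have "openin (gtopology N) {x \<in> topspace (gtopology N). f x \<in> {-1<..<1}}"
      by (rule openin_continuous_map_preimage) simp
    then have "openin M.mtopology {x. f x \<in> {-1<..<1}}"
      by (simp add: gtopology_def)
    then obtain r where "0 < r" and r: "M.mball 0 r \<subseteq> {x. f x \<in> {-1<..<1}}"
      unfolding M.openin_mtopology using linear_0[OF f]
      by (elim conjE allE[of _ "0::'a"]) auto
    have "\<bar>f x\<bar> \<le> 2 / r * nrm x" for x
    proof (cases "x = 0")
      case True
      then show ?thesis using linear_0[OF f] by simp
    next
      case False
      then have "0 < nrm x" using nrm_nonneg[of x] nrm_eq_zero_iff[of x] by linarith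
      \<comment> \<open>Half the radius puts \<open>c *\<^sub>R x\<close> strictly inside the ball,
        whence the constant \<open>2 / r\<close>.\<close>
      define c where "c = r / (2 * nrm x)"
      have c: "0 < c" "c * nrm x < r" using \<open>0 < nrm x\<close> \<open>0 < r\<close> by (simp_all add: c_def)
      then have "c *\<^sub>R x \<in> M.mball 0 r"
        by (simp add: gdist_nrm nrm_minus nrm_scaleR)
      then have "f (c *\<^sub>R x) \<in> {-1<..<1}" using r by blast
      then have "c * \<bar>f x\<bar> < 1" using c by (simp add: linear_scale[OF f] abs_mult flip: abs_less_iff) (simp add: abs_if split: if_splits)
      then show ?thesis using \<open>0 < nrm x\<close> \<open>0 < r\<close> by (simp add: c_def field_simps)
    qed
    then show "linear f \<and> (\<exists>M. \<forall>x. \<bar>f x\<bar> \<le> M * nrm x)" using f by blast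
  next
    assume "linear f \<and> (\<exists>M. \<forall>x. \<bar>f x\<bar> \<le> M * nrm x)"
    then obtain M where M: "\<And>x. \<bar>f x\<bar> \<le> M * nrm x" by blast
    have "openin M.mtopology {x. f x \<in> U}" if "open U" for U
      unfolding M.openin_mtopology
    proof (intro conjI allI impI)
      fix x assume "x \<in> {x. f x \<in> U}"
      then obtain e where e: "0 < e" "\<And>t. dist t (f x) < e \<Longrightarrow> t \<in> U"
        using \<open>open U\<close> by (auto simp: open_dist)
      have "M.mball x (e / (\<bar>M\<bar> + 1)) \<subseteq> {x. f x \<in> U}"
      proof
        fix y assume "y \<in> M.mball x (e / (\<bar>M\<bar> + 1))"
        then have y: "(\<bar>M\<bar> + 1) * nrm (x - y) < e" by (simp add: gdist_nrm field_simps)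
        have "dist (f y) (f x) = \<bar>f (x - y)\<bar>" by (simp add: linear_diff[OF f] dist_norm)
        also have "\<dots> \<le> M * nrm (x - y)" by (rule M)
        also have "\<dots> \<le> (\<bar>M\<bar> + 1) * nrm (x - y)" by (intro mult_right_mono) auto
        finally show "y \<in> {x. f x \<in> U}" using y e(2) by simp
      qed
      moreover have "0 < e / (\<bar>M\<bar> + 1)" using e(1) by simp
      ultimately show "\<exists>r>0. M.mball x r \<subseteq> {x. f x \<in> U}" by blast
    qed simp
    then show "f \<in> dual"
      using f by (simp add: dual_def continuous_map_def gtopology_def)
  qed
qed (simp add: dual_def)

lemma dual_linear: "f \<in> dual \<Longrightarrow> linear f"
  by (simp add: dual_def)

lemma continuous_map_weak: "f \<in> dual \<Longrightarrow> continuous_map (weak_topology N) euclideanreal f"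
proof -
  assume "f \<in> dual"
  then have "openin (weak_topology N) (f -` U)" if "open U" for U
    unfolding weak_topology_def using that
    by (intro topology_generated_by_Basis) (auto simp: dual_def)
  then show ?thesis
    by (simp add: continuous_map_def topspace_weak_topology vimage_def)
qed

text \<open>For the converse, the property that \<open>x k\<close> is eventually in \<open>U\<close>
  whenever \<open>l\<close> is survives finite intersections and arbitrary unions, so it is enough
  to check it on the generating preimages.\<close>

lemma limitin_weak_iff:
  "limitin (weak_topology N) x l sequentially \<longleftrightarrow> (\<forall>f\<in>dual. (\<lambda>k. f (x k)) \<longlonglongrightarrow> f l)"
proof
  assume lim: "limitin (weak_topology N) x l sequentially"
  show "\<forall>f\<in>dual. (\<lambda>k. f (x k)) \<longlonglongrightarrow> f l"
    using continuous_map_limit[OF continuous_map_weak lim] by (simp add: o_def)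
next
  assume lim: "\<forall>f\<in>dual. (\<lambda>k. f (x k)) \<longlonglongrightarrow> f l"
  have "l \<in> U \<longrightarrow> (\<forall>\<^sub>F k in sequentially. x k \<in> U)"
    if "generate_topology_on {f -` U | f U. linear f \<and> continuous_map (gtopology N) euclideanreal f \<and> open U} U" for U
    using that
  proof (induction rule: generate_topology_on.induct)
    case (Basis s)
    then obtain f U where s: "s = f -` U" "f \<in> dual" "open U" by (auto simp: dual_def)
    then have "(\<lambda>k. f (x k)) \<longlonglongrightarrow> f l" using lim by blast
    from topological_tendstoD[OF this s(3)] show ?case using s(1) by simp
  next
    case (UN K)
    show ?case
    proof
      assume "l \<in> \<Union>K"
      then obtain U where U: "U \<in> K" "l \<in> U" by blast
      then have "\<forall>\<^sub>F k in sequentially. x k \<in> U" using UN.IH by blast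
      then show "\<forall>\<^sub>F k in sequentially. x k \<in> \<Union>K" by (rule eventually_mono) (use U in blast)
    qed
  qed (auto intro: eventually_conj)
  then show "limitin (weak_topology N) x l sequentially"
    unfolding limitin_def topspace_weak_topology
    unfolding weak_topology_def openin_topology_generated_by_iff by blast
qed

lemma limitin_weak_of_nrm:
  assumes "(\<lambda>k. nrm (x k - l)) \<longlonglongrightarrow> 0"
  shows "limitin (weak_topology N) x l sequentially"
  unfolding limitin_weak_iff
proof
  fix f assume "f \<in> dual"
  then obtain M where f: "linear f" and M: "\<And>v. \<bar>f v\<bar> \<le> M * nrm v" by (auto simp: dual_iff)
  have "(\<lambda>k. f (x k) - f l) \<longlonglongrightarrow> 0"
  proof (rule Lim_null_comparison)
    show "\<forall>\<^sub>F k in sequentially. norm (f (x k) - f l) \<le> M * nrm (x k - l)"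
      using M[of "x _ - l"] by (simp add: linear_diff[OF f])
    show "(\<lambda>k. M * nrm (x k - l)) \<longlonglongrightarrow> 0"
      using tendsto_mult_left[OF assms, of M] by simp
  qed
  then show "(\<lambda>k. f (x k)) \<longlonglongrightarrow> f l" by (simp add: LIM_zero_iff)
qed

text \<open>The norm is at least some \<open>r > 0\<close> on \<open>z - K\<close>.
  \<open>sublinear_decrease\<close> lowers it to a sublinear \<open>q\<close> with
  \<open>q (k - z) <= - r\<close> for \<open>k\<close> in \<open>K\<close>, and a linear functional
  below \<open>q\<close> is bounded by the norm and separates.\<close>

lemma separation:
  assumes K: "closedin (gtopology N) K" "convex K" "K \<noteq> {}" and "z \<notin> K"
  shows "\<exists>f\<in>dual. \<exists>r>0. \<forall>k\<in>K. f k \<le> f z - r"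
proof -
  from K(1) \<open>z \<notin> K\<close> obtain r where "0 < r" and r: "disjnt K (M.mball z r)"
    unfolding gtopology_def M.closedin_metric by blast
  have dist: "r \<le> nrm (z - k)" if "k \<in> K" for k
    using r that by (auto simp: disjnt_iff gdist_nrm not_less)
  have "sublinear nrm"
    by (rule sublinearI) (simp_all add: nrm_triangle nrm_scaleR)
  moreover have "convex ((\<lambda>k. z - k) ` K)"
    using K(2) convex_translation[of "uminus ` K" z] convex_negations[OF K(2)] by (simp add: image_image)
  moreover have "(\<lambda>k. z - k) ` K \<noteq> {}" using K(3) by simp
  moreover have "r \<le> nrm a" if "a \<in> (\<lambda>k. z - k) ` K" for a using that dist by auto
  ultimately obtain q where q: "sublinear q" "\<And>x. q x \<le> nrm x" "\<And>a. a \<in> (\<lambda>k. z - k) ` K \<Longrightarrow> q (- a) \<le> - r"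
    using sublinear_decrease[of nrm "(\<lambda>k. z - k) ` K" r] by blast
  obtain f where f: "linear f" "\<And>x. f x \<le> q x" using linear_below_sublinear[OF q(1)] by blast
  have "\<bar>f x\<bar> \<le> 1 * nrm x" for x
    using order_trans[OF f(2) q(2), of x] order_trans[OF f(2) q(2), of "- x"]
    by (simp add: linear_neg[OF f(1)] nrm_minus)
  then have "f \<in> dual" using f(1) unfolding dual_iff by blast
  moreover have "f k \<le> f z - r" if "k \<in> K" for k
  proof -
    have "f (k - z) \<le> q (- (z - k))" using f(2)[of "k - z"] by simp
    also have "\<dots> \<le> - r" using q(3)[of "z - k"] that by blast
    finally show ?thesis by (simp add: linear_diff[OF f(1)])
  qed
  ultimately show ?thesis using \<open>0 < r\<close> by blast
qed

text \<open>Mazur's theorem: the open half-space \<open>f x > f z - r\<close> from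
  \<open>separation\<close> is a weak neighbourhood of \<open>z\<close> that misses
  \<open>K\<close>.\<close>

lemma closedin_weak:
  assumes K: "closedin (gtopology N) K" "convex K"
  shows "closedin (weak_topology N) K"
proof (cases "K = {}")
  case False
  have "\<exists>U. openin (weak_topology N) U \<and> z \<in> U \<and> U \<subseteq> - K" if z: "z \<notin> K" for z
  proof -
    obtain f r where f: "f \<in> dual" and "0 < r" and sep: "\<And>k. k \<in> K \<Longrightarrow> f k \<le> f z - r"
      using separation[OF K False z] by blast
    have "openin (weak_topology N) {x \<in> topspace (weak_topology N). f x \<in> {f z - r<..}}"
      using continuous_map_weak[OF f] by (rule openin_continuous_map_preimage) simp
    moreover have "z \<in> {x \<in> topspace (weak_topology N). f x \<in> {f z - r<..}}"
      using \<open>0 < r\<close> by (simp add: topspace_weak_topology)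
    moreover have "{x \<in> topspace (weak_topology N). f x \<in> {f z - r<..}} \<subseteq> - K"
      using sep by (auto simp: not_less[symmetric])
    ultimately show ?thesis by blast
  qed
  then have "openin (weak_topology N) (- K)"
    by (subst openin_subopen) blast
  then show ?thesis
    by (simp add: closedin_def topspace_weak_topology Compl_eq_Diff_UNIV)
qed simp

text \<open>The dual separates points, by \<open>separation\<close> from the closed convex set
  \<open>{l'}\<close>.\<close>

lemma limitin_weak_unique:
  assumes "limitin (weak_topology N) x l sequentially" and "limitin (weak_topology N) x l' sequentially"
  shows "l = l'"
proof (rule ccontr)
  assume "l \<noteq> l'"
  have "closedin (gtopology N) {l'}"
    unfolding gtopology_def
    by (intro closedin_Hausdorff_singleton M.Hausdorff_space_mtopology) simp
  then obtain f r where f: "f \<in> dual" "0 < r" and sep: "\<And>k. k \<in> {l'} \<Longrightarrow> f k \<le> f l - r"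
    using separation[of "{l'}" l] \<open>l \<noteq> l'\<close> by auto
  have "f l = f l'"
    using assms f(1) LIMSEQ_unique unfolding limitin_weak_iff by blast
  with sep f(2) show False by simp
qed

section \<open>Fixed points\<close>

text \<open>Evaluation at a dense sequence embeds \<open>L\<close> into a second countable space, all of whose
  subsets are separable.\<close>

lemma pointwise_dense_sequence:
  fixes d :: "nat \<Rightarrow> 'a"
  assumes L: "\<And>g. g \<in> L \<Longrightarrow> linear g" "\<And>g x. g \<in> L \<Longrightarrow> \<bar>g x\<bar> \<le> nrm x" and "L \<noteq> {}"
  shows "\<exists>f :: nat \<Rightarrow> 'a \<Rightarrow> real. (\<forall>j. f j \<in> L) \<and>
    (\<forall>g\<in>L. \<exists>s. \<forall>x\<in>gtopology N closure_of range d. (\<lambda>n. f (s n) x) \<longlonglongrightarrow> g x)"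
proof -
  define ev :: "('a \<Rightarrow> real) \<Rightarrow> nat \<Rightarrow> real" where "ev g n = g (d n)" for g n
  obtain E where E: "countable E" "E \<subseteq> ev ` L" "ev ` L \<subseteq> closure E"
    by (rule separable[of "ev ` L"])
  have "E \<noteq> {}" using E(3) \<open>L \<noteq> {}\<close> by auto
  have "\<forall>j. \<exists>g\<in>L. from_nat_into E j = ev g"
    using from_nat_into[OF \<open>E \<noteq> {}\<close>] E(2) by blast
  then obtain f where f: "\<And>j. f j \<in> L" "\<And>j. from_nat_into E j = ev (f j)" by metis
  have "\<exists>s. \<forall>x\<in>gtopology N closure_of range d. (\<lambda>n. f (s n) x) \<longlonglongrightarrow> g x" if g: "g \<in> L" for g
  proof -
    have "ev g \<in> closure E" using E(3) g by blast
    then obtain y where y: "\<And>n. y n \<in> E" "y \<longlonglongrightarrow> ev g"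
      unfolding closure_sequential by blast
    have "\<forall>n. \<exists>j. y n = ev (f j)"
      using y(1) from_nat_into_surj[OF E(1)] f(2) by metis
    then obtain s where s: "\<And>n. y n = ev (f (s n))" by metis
    have lim: "(\<lambda>n. f (s n) (d m)) \<longlonglongrightarrow> g (d m)" for m
    proof -
      have "continuous_on UNIV (\<lambda>u::nat \<Rightarrow> real. u m)" by simp
      then have "isCont (\<lambda>u::nat \<Rightarrow> real. u m) (ev g)"
        by (simp add: continuous_on_eq_continuous_at[OF open_UNIV] del: continuous_on_product_coordinates)
      from isCont_tendsto_compose[OF this y(2)] show ?thesis by (simp add: s ev_def)
    qed
    have "(\<lambda>n. f (s n) x) \<longlonglongrightarrow> g x" if x: "x \<in> gtopology N closure_of range d" for x
    proof (rule LIMSEQ_I)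
      fix e :: real assume "0 < e"
      then have "0 < e / 3" by simp
      then obtain m where m: "nrm (x - d m) < e / 3"
        using x unfolding in_closure_of by blast
      obtain n0 where n0: "\<And>n. n0 \<le> n \<Longrightarrow> \<bar>f (s n) (d m) - g (d m)\<bar> < e / 3"
        using LIMSEQ_D[OF lim[of m], of "e / 3"] \<open>0 < e\<close> by auto
      have "norm (f (s n) x - g x) < e" if "n0 \<le> n" for n
      proof -
        have "\<bar>f (s n) (x - d m)\<bar> < e / 3" "\<bar>g (x - d m)\<bar> < e / 3"
          using L(2)[OF f(1), of "s n" "x - d m"] L(2)[OF g, of "x - d m"] m by linarith+
        then have "\<bar>f (s n) x - f (s n) (d m)\<bar> < e / 3" "\<bar>g x - g (d m)\<bar> < e / 3"
          by (simp_all add: linear_diff[OF L(1)[OF f(1)]] linear_diff[OF L(1)[OF g]])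
        with n0[OF that] show ?thesis unfolding real_norm_def by linarith
      qed
      then show "\<exists>no. \<forall>n\<ge>no. norm (f (s n) x - g x) < e" by blast
    qed
    then show ?thesis by blast
  qed
  with f(1) show ?thesis by blast
qed

text \<open>Schauder projection: finitely many points \<open>c i\<close> form an
  \<open>e\<close>-net of \<open>C\<close> for the functionals in \<open>fs\<close>, and Brouwer's
  theorem finds \<open>z\<close> equal to the projection of \<open>T z\<close> onto their convex
  hull.\<close>

lemma approximate_fixed_point:
  assumes C: "compactin (weak_topology N) C" "C \<noteq> {}" "C \<subseteq> K" and K: "convex K"
    and T: "T ` K \<subseteq> C" "weakly_sequentially_continuous_on N K T"
    and fs: "finite fs" "fs \<subseteq> dual" and "0 < e"
  shows "\<exists>z\<in>convex hull C. \<forall>f\<in>fs. \<bar>f z - f (T z)\<bar> \<le> e"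
proof -
  define p where "p x y = (\<Sum>f\<in>fs. \<bar>f x - f y\<bar>)" for x y
  have p_cont: "continuous_map (weak_topology N) euclideanreal (\<lambda>x. p x y)" for y
    unfolding p_def
  proof (intro continuous_map_sum fs(1) continuous_map_real_abs continuous_map_diff)
    show "continuous_map (weak_topology N) euclideanreal f" if "f \<in> fs" for f
      using that fs(2) continuous_map_weak by blast
  qed simp
  define U where "U c = {x. p x c < e}" for c
  have "\<exists>\<F>. finite \<F> \<and> \<F> \<subseteq> U ` C \<and> C \<subseteq> \<Union>\<F>"
  proof (rule compactinD[OF C(1)])
    have "openin (weak_topology N) {x \<in> topspace (weak_topology N). p x c \<in> {..<e}}" for c
      using p_cont by (rule openin_continuous_map_preimage) simp
    then show "openin (weak_topology N) V" if "V \<in> U ` C" for V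
      using that by (auto simp: U_def topspace_weak_topology)
    show "C \<subseteq> \<Union>(U ` C)" using \<open>0 < e\<close> by (auto simp: U_def p_def)
  qed
  then obtain V where V: "finite V" "V \<subseteq> C" "C \<subseteq> (\<Union>c\<in>V. U c)"
    by (metis finite_subset_image)
  then obtain c n where c: "V = c ` {i::nat. i < n}"
    using finite_imp_nat_seg_image_inj_on[OF V(1)] by blast
  have cC: "c i \<in> C" if "i < n" for i using that V(2) c by blast
  have n: "0 < n" using V(3) C(2) c by (cases n) auto
  \<comment> \<open>An unnormalized partition of unity: \<open>w i\<close> vanishes outside
    \<open>U (c i)\<close>, and \<open>W\<close> is positive on \<open>C\<close> because these sets
    cover it.\<close>
  define w where "w i x = max 0 (e - p x (c i))" for i x
  define W where "W x = (\<Sum>i<n. w i x)" for x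
  have w_nonneg: "0 \<le> w i x" for i x by (simp add: w_def)
  have W_pos: "0 < W x" if xC: "x \<in> C" for x
  proof -
    obtain i where i: "i < n" "p x (c i) < e" using V(3) xC unfolding c U_def by blast
    have "0 < w i x" using i(2) by (simp add: w_def)
    also have "\<dots> \<le> W x"
      unfolding W_def using i(1) by (intro member_le_sum) (auto simp: w_nonneg)
    finally show ?thesis .
  qed
  define \<sigma> where "\<sigma> x = (\<Sum>i<n. x i)" for x :: "nat \<Rightarrow> real"
  \<comment> \<open>\<open>r\<close> maps the cube into the standard simplex and is the identity there.\<close>
  define r where "r x i = (x i + \<bar>1 - \<sigma> x\<bar>) / (\<sigma> x + real n * \<bar>1 - \<sigma> x\<bar>)" for x i
  define z where "z x = (\<Sum>i<n. r x i *\<^sub>R c i)" for x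
  define Q where "Q = {x :: nat \<Rightarrow> real. \<forall>i. 0 \<le> x i \<and> x i \<le> 1}"
  \<comment> \<open>At \<open>\<sigma> x = 0\<close> the second summand equals \<open>n\<close>,
    which is positive because \<open>C\<close> is nonempty.\<close>
  have den_pos: "0 < \<sigma> x + real n * \<bar>1 - \<sigma> x\<bar>" if "x \<in> Q" for x
  proof -
    have "0 \<le> \<sigma> x" unfolding \<sigma>_def using that by (intro sum_nonneg) (simp add: Q_def)
    moreover have "0 \<le> real n * \<bar>1 - \<sigma> x\<bar>" by simp
    moreover have "\<sigma> x = 0 \<Longrightarrow> 0 < real n * \<bar>1 - \<sigma> x\<bar>" using n by simp
    ultimately show ?thesis by linarith
  qed
  have r_nonneg: "0 \<le> r x i" if "x \<in> Q" for x i
    unfolding r_def using that den_pos[OF that] by (intro divide_nonneg_pos add_nonneg_nonneg) (auto simp: Q_def)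
  have r_sum: "(\<Sum>i<n. r x i) = 1" if "x \<in> Q" for x
    using den_pos[OF that] by (simp add: r_def sum.distrib flip: sum_divide_distrib \<sigma>_def)
  have z_hull: "z x \<in> convex hull C" if "x \<in> Q" for x
    unfolding z_def
    by (rule convex_sum) (use that in \<open>auto simp: r_nonneg r_sum cC hull_inc\<close>)
  have hull_K: "convex hull C \<subseteq> K" using C(3) K by (rule hull_minimal)
  have zK: "z x \<in> K" and TzC: "T (z x) \<in> C" if "x \<in> Q" for x
    using z_hull[OF that] hull_K T(1) by blast+
  \<comment> \<open>The barycentric coordinates of the Schauder projection of
    \<open>T (z x)\<close>.\<close>
  define G where "G x i = w i (T (z x)) / W (T (z x))" for x i
  have "\<exists>x\<in>{x. \<forall>i. 0 \<le> x i \<and> x i \<le> 1}. \<forall>i<n. G x i = x i"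
  proof (rule brouwer_unit_cube)
    fix x :: "nat \<Rightarrow> real" and i
    assume "x \<in> {x. \<forall>i. 0 \<le> x i \<and> x i \<le> 1}" and "i < n"
    then have x: "x \<in> Q" by (simp add: Q_def)
    have "w i (T (z x)) \<le> W (T (z x))"
      unfolding W_def using \<open>i < n\<close> by (intro member_le_sum) (auto simp: w_nonneg)
    then show "0 \<le> G x i \<and> G x i \<le> 1"
      using W_pos[OF TzC[OF x]] by (simp add: G_def w_nonneg divide_le_eq)
  next
    fix x :: "nat \<Rightarrow> nat \<Rightarrow> real" and l i
    assume "\<And>k. x k \<in> {x. \<forall>i. 0 \<le> x i \<and> x i \<le> 1}" and "l \<in> {x. \<forall>i. 0 \<le> x i \<and> x i \<le> 1}"
      and lim: "\<And>j. j < n \<Longrightarrow> (\<lambda>k. x k j) \<longlonglongrightarrow> l j" and "i < n"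
    then have x: "x k \<in> Q" and l: "l \<in> Q" for k by (auto simp: Q_def)
    have \<sigma>_lim: "(\<lambda>k. \<sigma> (x k)) \<longlonglongrightarrow> \<sigma> l"
      unfolding \<sigma>_def by (intro tendsto_sum lim) simp
    have r_lim: "(\<lambda>k. r (x k) j) \<longlonglongrightarrow> r l j" if "j < n" for j
      unfolding r_def using den_pos[OF l] by (intro tendsto_intros \<sigma>_lim lim that) simp
    \<comment> \<open>Convergence of finitely many coefficients gives weak convergence of the
      sequence \<open>z (x k)\<close>, to which weak sequential continuity of \<open>T\<close>
      applies.\<close>
    have "limitin (weak_topology N) (\<lambda>k. z (x k)) (z l) sequentially"
      unfolding limitin_weak_iff
    proof
      fix f assume "f \<in> dual"
      then have f: "linear f" by (rule dual_linear)
      show "(\<lambda>k. f (z (x k))) \<longlonglongrightarrow> f (z l)"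
        unfolding z_def linear_sum[OF f] linear_scale[OF f]
        by (intro tendsto_sum tendsto_scaleR tendsto_const r_lim) simp
    qed
    then have Tlim: "limitin (weak_topology N) (\<lambda>k. T (z (x k))) (T (z l)) sequentially"
      by (rule weakly_sequentially_continuous_onD[OF T(2) zK[OF x] zK[OF l]])
    have p_lim: "(\<lambda>k. p (T (z (x k))) (c j)) \<longlonglongrightarrow> p (T (z l)) (c j)" for j
      using continuous_map_limit[OF p_cont Tlim] by (simp add: o_def)
    have w_lim: "(\<lambda>k. w j (T (z (x k)))) \<longlonglongrightarrow> w j (T (z l))" for j
      unfolding w_def by (intro tendsto_intros p_lim)
    have W_lim: "(\<lambda>k. W (T (z (x k)))) \<longlonglongrightarrow> W (T (z l))"
      unfolding W_def by (intro tendsto_sum w_lim)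
    show "(\<lambda>k. G (x k) i) \<longlonglongrightarrow> G l i"
      unfolding G_def using W_pos[OF TzC[OF l]] by (intro tendsto_divide w_lim W_lim) simp
  qed
  then obtain x where x: "x \<in> Q" and fixed: "\<And>i. i < n \<Longrightarrow> G x i = x i" by (auto simp: Q_def)
  \<comment> \<open>The fixed coordinates sum to 1, so \<open>r x\<close> agrees with
    \<open>x\<close> and \<open>z x\<close> is the convex combination with weights
    \<open>x i\<close>.\<close>
  have "\<sigma> x = (\<Sum>i<n. G x i)" unfolding \<sigma>_def using fixed by simp
  also have "\<dots> = 1"
    using W_pos[OF TzC[OF x]] by (simp add: G_def W_def flip: sum_divide_distrib)
  finally have \<sigma>1: "\<sigma> x = 1" .
  have "\<bar>f (z x) - f (T (z x))\<bar> \<le> e" if f: "f \<in> fs" for f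
  proof -
    have lin: "linear f" using f fs(2) dual_linear by blast
    have "f (z x) = (\<Sum>i<n. x i * f (c i))"
      by (simp add: z_def r_def \<sigma>1 linear_sum[OF lin] linear_scale[OF lin])
    moreover have "f (T (z x)) = (\<Sum>i<n. x i * f (T (z x)))"
      using \<sigma>1 by (simp add: \<sigma>_def flip: sum_distrib_right)
    ultimately have "\<bar>f (z x) - f (T (z x))\<bar> = \<bar>\<Sum>i<n. x i * (f (c i) - f (T (z x)))\<bar>"
      by (simp add: sum_subtractf right_diff_distrib)
    also have "\<dots> \<le> (\<Sum>i<n. \<bar>x i * (f (c i) - f (T (z x)))\<bar>)" by (rule sum_abs)
    also have "\<dots> \<le> (\<Sum>i<n. x i * e)"
    proof (rule sum_mono)
      fix i assume "i \<in> {..<n}"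
      then have i: "i < n" by simp
      have "0 \<le> x i" using x by (simp add: Q_def)
      show "\<bar>x i * (f (c i) - f (T (z x)))\<bar> \<le> x i * e"
      \<comment> \<open>A nonzero weight means that \<open>c i\<close> is within \<open>e\<close> of
        \<open>T (z x)\<close> for \<open>p\<close>.\<close>
      proof (cases "x i = 0")
        case False
        then have "w i (T (z x)) \<noteq> 0" using fixed[OF i] by (auto simp: G_def)
        then have "p (T (z x)) (c i) \<le> e" by (simp add: w_def max_def split: if_splits)
        moreover have "\<bar>f (T (z x)) - f (c i)\<bar> \<le> p (T (z x)) (c i)"
          unfolding p_def using fs(1) f by (intro member_le_sum) auto
        ultimately have "\<bar>f (c i) - f (T (z x))\<bar> \<le> e" by linarith
        then show ?thesis using \<open>0 \<le> x i\<close> by (simp add: abs_mult mult_left_mono)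
      qed simp
    qed
    also have "\<dots> = e" using \<sigma>1 by (simp add: \<sigma>_def flip: sum_distrib_right)
    finally show ?thesis .
  qed
  with z_hull[OF x] show ?thesis by blast
qed

text \<open>Convergence against the sequence \<open>f\<close> only is tested; it passes to pointwise limits of
  subsequences of \<open>f\<close> by dominated convergence.\<close>

lemma limitin_weak_of_dense_sequence:
  assumes C: "compactin (weak_topology N) C" and "y \<in> C"
    and f: "\<And>j. f j \<in> dual" "\<And>j c. c \<in> C \<Longrightarrow> \<bar>f j c\<bar> \<le> 1"
    and dense: "\<And>g. g \<in> dual \<Longrightarrow> (\<And>x. \<bar>g x\<bar> \<le> nrm x) \<Longrightarrow> (\<And>c. c \<in> C \<Longrightarrow> \<bar>g c\<bar> \<le> 1)
      \<Longrightarrow> \<exists>q :: nat \<Rightarrow> nat. \<forall>c\<in>C. (\<lambda>n. f (q n) c) \<longlonglongrightarrow> g c"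
    and v: "\<And>k. v k \<in> convex hull C" and lim: "\<And>j. (\<lambda>k. f j (v k)) \<longlonglongrightarrow> f j y"
  shows "limitin (weak_topology N) v y sequentially"
proof -
  \<comment> \<open>Functionals bounded by \<open>nrm\<close>, and by 1 on \<open>C\<close>, come
    first; the general case follows by rescaling.\<close>
  have unit: "(\<lambda>k. g (v k)) \<longlonglongrightarrow> g y"
    if g: "g \<in> dual" "\<And>x. \<bar>g x\<bar> \<le> nrm x" "\<And>c. c \<in> C \<Longrightarrow> \<bar>g c\<bar> \<le> 1" for g
  proof (rule ccontr)
    assume "\<not> (\<lambda>k. g (v k)) \<longlonglongrightarrow> g y"
    then obtain e where "0 < e" and e: "\<And>m. \<exists>k\<ge>m. e \<le> \<bar>g (v k) - g y\<bar>"
      unfolding LIMSEQ_def dist_real_def by (meson not_less)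
    have "infinite {k. e \<le> \<bar>g (v k) - g y\<bar>}"
      unfolding infinite_nat_iff_unbounded_le using e by blast
    from infinite_enumerate[OF this]
    obtain t :: "nat \<Rightarrow> nat" where t: "strict_mono t" and t_ge: "\<And>k. e \<le> \<bar>g (v (t k)) - g y\<bar>"
      by blast
    obtain q :: "nat \<Rightarrow> nat" where q: "\<And>c. c \<in> C \<Longrightarrow> (\<lambda>n. f (q n) c) \<longlonglongrightarrow> g c"
      using dense[OF g] by blast
    obtain n0 where n0: "\<And>n. n0 \<le> n \<Longrightarrow> \<bar>f (q n) y - g y\<bar> < e / 4"
      using LIMSEQ_D[OF q[OF \<open>y \<in> C\<close>], of "e / 4"] \<open>0 < e\<close> by auto
    \<comment> \<open>The shift by \<open>n0\<close> makes \<open>\<bar>h n y\<bar>\<close> less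
      than \<open>e / 4\<close> for every \<open>n\<close>, while \<open>h n\<close> still tends to
      0 on \<open>C\<close>.\<close>
    define h where "h n x = f (q (n0 + n)) x - g x" for n x
    have lin: "linear (h n)" for n
      unfolding h_def using f(1) g(1) by (intro linear_compose_sub) (auto dest: dual_linear)
    have "\<forall>k. \<exists>V w. finite V \<and> V \<subseteq> C \<and> (\<forall>c\<in>V. 0 \<le> w c) \<and> sum w V = 1 \<and> (\<Sum>c\<in>V. w c *\<^sub>R c) = v (t k)"
      using v unfolding convex_hull_explicit by blast
    then obtain V w where Vw: "\<forall>k. finite (V k) \<and> V k \<subseteq> C \<and> (\<forall>c\<in>V k. 0 \<le> w k c) \<and> sum (w k) (V k) = 1
        \<and> (\<Sum>c\<in>V k. w k c *\<^sub>R c) = v (t k)"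
      unfolding choice_iff by (elim exE)
    have avg: "(\<Sum>c\<in>V k. w k c * h n c) = h n (v (t k))" for n k
    proof -
      have "v (t k) = (\<Sum>c\<in>V k. w k c *\<^sub>R c)" using Vw by simp
      then show ?thesis by (simp add: linear_sum[OF lin] linear_scale[OF lin])
    qed
    have "\<exists>n. \<not> (\<forall>\<^sub>F k in sequentially. e / 2 \<le> \<bar>\<Sum>c\<in>V k. w k c * h n c\<bar>)"
    proof (rule averages_of_null_sequence[where X = "subtopology (weak_topology N) C" and C = C])
      show "compactin (subtopology (weak_topology N) C) C" using C by (simp add: compactin_subtopology)
    next
      fix n and a :: real
      have "continuous_map (weak_topology N) euclideanreal (\<lambda>x. \<bar>h n x\<bar>)"
        unfolding h_def using f(1) g(1)
        by (intro continuous_map_real_abs continuous_map_diff continuous_map_weak) (auto intro: continuous_map_weak)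
      then have "closedin (weak_topology N) {x \<in> topspace (weak_topology N). \<bar>h n x\<bar> \<in> {a..}}"
        by (rule closedin_continuous_map_preimage) simp
      then show "closedin (subtopology (weak_topology N) C) {c \<in> C. a \<le> \<bar>h n c\<bar>}"
        unfolding closedin_subtopology by (intro exI conjI) (auto simp: topspace_weak_topology)
    next
      fix n c assume "c \<in> C"
      then show "\<bar>h n c\<bar> \<le> 2" using f(2)[of c "q (n0 + n)"] g(3)[of c] unfolding h_def by linarith
    next
      fix c assume "c \<in> C"
      from LIMSEQ_ignore_initial_segment[OF q[OF this], of n0]
      show "(\<lambda>n. h n c) \<longlonglongrightarrow> 0"
        unfolding h_def by (intro LIM_zero) (simp add: add.commute)
    qed (use Vw \<open>0 < e\<close> in auto)
    then obtain n where "\<not> (\<forall>\<^sub>F k in sequentially. e / 2 \<le> \<bar>h n (v (t k))\<bar>)"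
      unfolding avg by blast
    \<comment> \<open>\<open>g (v (t k))\<close> is at least \<open>e\<close> away from
      \<open>g y\<close>, whereas \<open>f (q (n0 + n))\<close> at \<open>v (t k)\<close> is
      eventually within \<open>e / 4\<close> of its value at \<open>y\<close>, itself within
      \<open>e / 4\<close> of \<open>g y\<close>. This leaves \<open>e / 2\<close>.\<close>
    moreover have "\<forall>\<^sub>F k in sequentially. e / 2 \<le> \<bar>h n (v (t k))\<bar>"
    proof -
      have "(\<lambda>k. f (q (n0 + n)) (v (t k))) \<longlonglongrightarrow> f (q (n0 + n)) y"
        using LIMSEQ_subseq_LIMSEQ[OF lim t] by (simp add: o_def)
      then have "\<forall>\<^sub>F k in sequentially. dist (f (q (n0 + n)) (v (t k))) (f (q (n0 + n)) y) < e / 4"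
        by (rule tendstoD) (use \<open>0 < e\<close> in simp)
      then show ?thesis
      proof eventually_elim
        case (elim k)
        then show ?case
          using n0[of "n0 + n"] t_ge[of k] unfolding h_def dist_real_def by linarith
      qed
    qed
    ultimately show False by blast
  qed
  show ?thesis
    unfolding limitin_weak_iff
  proof
    fix g assume g: "g \<in> dual"
    then obtain B where B: "\<And>x. \<bar>g x\<bar> \<le> B * nrm x" and lin: "linear g" unfolding dual_iff by blast
    have "compact (g ` C)"
      using image_compactin[OF C continuous_map_weak[OF g]] by simp
    then have "bounded (g ` C)" by (rule compact_imp_bounded)
    then obtain B' where B': "\<And>c. c \<in> C \<Longrightarrow> \<bar>g c\<bar> \<le> B'"
      unfolding bounded_iff real_norm_def by blast
    \<comment> \<open>\<open>s\<close> scales both bounds, \<open>B\<close> for the norm and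
      \<open>B'\<close> on \<open>C\<close>, to at most 1.\<close>
    define s where "s = 1 / (1 + \<bar>B\<bar> + \<bar>B'\<bar>)"
    have "0 < 1 + \<bar>B\<bar> + \<bar>B'\<bar>" by (simp add: add_pos_nonneg)
    then have s: "0 < s" "s * \<bar>B\<bar> \<le> 1" "s * \<bar>B'\<bar> \<le> 1" by (simp_all add: s_def divide_le_eq)
    have "(\<lambda>k. s * g (v k)) \<longlonglongrightarrow> s * g y"
    proof (rule unit)
      have "\<bar>s * g x\<bar> \<le> nrm x" for x
      proof -
        have "\<bar>s * g x\<bar> \<le> s * (\<bar>B\<bar> * nrm x)"
          using s(1) order_trans[OF B[of x] mult_right_mono[OF abs_ge_self nrm_nonneg]]
          by (simp add: abs_mult mult_left_mono)
        also have "\<dots> \<le> nrm x" using s(2) mult_right_mono[of "s * \<bar>B\<bar>" 1 "nrm x"] by simp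
        finally show ?thesis .
      qed
      then show "\<bar>s * g x\<bar> \<le> nrm x" for x .
      then have "\<forall>x. \<bar>s * g x\<bar> \<le> 1 * nrm x" by simp
      moreover have "linear (\<lambda>x. s * g x)"
        using linear_compose_scale_right[OF lin, of s] by simp
      ultimately show "(\<lambda>x. s * g x) \<in> dual" unfolding dual_iff by blast
      show "\<bar>s * g c\<bar> \<le> 1" if "c \<in> C" for c
      proof -
        have "\<bar>s * g c\<bar> \<le> s * \<bar>B'\<bar>"
          using s(1) B'[OF that] by (simp add: abs_mult mult_left_mono)
        then show ?thesis using s(3) by simp
      qed
    qed
    then have "(\<lambda>k. inverse s * (s * g (v k))) \<longlonglongrightarrow> inverse s * (s * g y)"
      by (rule tendsto_mult_left)
    then show "(\<lambda>k. g (v k)) \<longlonglongrightarrow> g y" using s(1) by (simp add: mult.assoc[symmetric])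
  qed
qed

lemma fixed_point_separable:
  fixes d :: "nat \<Rightarrow> 'a"
  assumes C: "compactin (weak_topology N) C" "C \<noteq> {}" "C \<subseteq> K"
    and K: "convex K" "K \<subseteq> gtopology N closure_of range d"
    and T: "T ` K \<subseteq> C" "weakly_sequentially_continuous_on N K T"
  shows "\<exists>x\<in>K. T x = x"
proof -
  define L where "L = {g \<in> dual. (\<forall>x. \<bar>g x\<bar> \<le> nrm x) \<and> (\<forall>c\<in>C. \<bar>g c\<bar> \<le> 1)}"
  have "(\<lambda>_. 0) \<in> L" by (simp add: L_def dual_def linear_zero)
  then have "L \<noteq> {}" by blast
  have "\<exists>f :: nat \<Rightarrow> 'a \<Rightarrow> real. (\<forall>j. f j \<in> L) \<and>
      (\<forall>g\<in>L. \<exists>s. \<forall>x\<in>gtopology N closure_of range d. (\<lambda>n. f (s n) x) \<longlonglongrightarrow> g x)"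
    by (rule pointwise_dense_sequence) (use \<open>L \<noteq> {}\<close> in \<open>auto simp: L_def dual_linear\<close>)
  then obtain f :: "nat \<Rightarrow> 'a \<Rightarrow> real" where fL: "\<And>j. f j \<in> L" and dense:
    "\<And>g. g \<in> L \<Longrightarrow> \<exists>s. \<forall>x\<in>gtopology N closure_of range d. (\<lambda>n. f (s n) x) \<longlonglongrightarrow> g x"
    by blast
  have f: "f j \<in> dual" "\<And>c. c \<in> C \<Longrightarrow> \<bar>f j c\<bar> \<le> 1" for j using fL[of j] by (auto simp: L_def)
  \<comment> \<open>The \<open>k\<close>-th point serves the first \<open>k + 1\<close> functionals
    with error \<open>1 / (k + 1)\<close>, so for each fixed \<open>j\<close> the difference tends
    to 0.\<close>
  have "\<forall>k. \<exists>z\<in>convex hull C. \<forall>g\<in>f ` {..k}. \<bar>g z - g (T z)\<bar> \<le> 1 / real (Suc k)"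
    by (intro allI approximate_fixed_point[OF C K(1) T]) (auto simp: f)
  then obtain z where z: "\<And>k. z k \<in> convex hull C"
    and z_fixed: "\<And>k g. g \<in> f ` {..k} \<Longrightarrow> \<bar>g (z k) - g (T (z k))\<bar> \<le> 1 / real (Suc k)" by metis
  have "convex hull C \<subseteq> K" using C(3) K(1) by (rule hull_minimal)
  with z have zK: "z k \<in> K" for k by blast
  with T(1) have TzC: "T (z k) \<in> C" for k by blast
  \<comment> \<open>The image of \<open>C\<close> under all \<open>f j\<close> is compact in a
    metrizable product, so a subsequence converges there; \<open>y\<close> is a preimage in
    \<open>C\<close> of its limit.\<close>
  have "continuous_map (weak_topology N) euclidean (\<lambda>x j. f j x)"
    unfolding euclidean_product_topology[symmetric] continuous_map_componentwise_UNIV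
    using f(1) continuous_map_weak by blast
  from image_compactin[OF C(1) this] have "compact ((\<lambda>x j. f j x) ` C)" by simp
  then have "seq_compact ((\<lambda>x j. f j x) ` C)" using compact_eq_seq_compact_metric by blast
  moreover have "\<forall>k. (\<lambda>j. f j (T (z k))) \<in> (\<lambda>x j. f j x) ` C" using TzC by blast
  ultimately obtain l s where l: "l \<in> (\<lambda>x j. f j x) ` C" and s: "strict_mono s"
    and lim: "((\<lambda>k j. f j (T (z k))) \<circ> s) \<longlonglongrightarrow> l"
    by (rule seq_compactE)
  obtain y where y: "y \<in> C" and ly: "l = (\<lambda>j. f j y)" using l by blast
  have Tz_lim: "(\<lambda>k. f j (T (z (s k)))) \<longlonglongrightarrow> f j y" for j
  proof -
    have "continuous_on UNIV (\<lambda>u::nat \<Rightarrow> real. u j)" by simp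
    then have "isCont (\<lambda>u::nat \<Rightarrow> real. u j) l"
      by (simp add: continuous_on_eq_continuous_at[OF open_UNIV] del: continuous_on_product_coordinates)
    from isCont_tendsto_compose[OF this lim] show ?thesis by (simp add: ly o_def)
  qed
  have z_lim: "(\<lambda>k. f j (z (s k))) \<longlonglongrightarrow> f j y" for j
  proof -
    have "(\<lambda>k. f j (z k) - f j (T (z k))) \<longlonglongrightarrow> 0"
    proof (rule Lim_null_comparison)
      show "\<forall>\<^sub>F k in sequentially. norm (f j (z k) - f j (T (z k))) \<le> inverse (real (Suc k))"
        using eventually_ge_at_top[of j]
        by eventually_elim (use z_fixed in \<open>simp add: inverse_eq_divide\<close>)
      show "(\<lambda>k. inverse (real (Suc k))) \<longlonglongrightarrow> 0" by (rule LIMSEQ_inverse_real_of_nat)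
    qed
    from LIMSEQ_subseq_LIMSEQ[OF this s]
    have "(\<lambda>k. f j (z (s k)) - f j (T (z (s k)))) \<longlonglongrightarrow> 0" by (simp add: o_def)
    from tendsto_add[OF this Tz_lim[of j]] show ?thesis by simp
  qed
  \<comment> \<open>Used for both \<open>z (s k)\<close> and \<open>T (z (s k))\<close>, which lie
    in the hull of \<open>C\<close> and have the same limits along every \<open>f j\<close>.\<close>
  have test: "limitin (weak_topology N) v y sequentially"
    if v: "\<And>k. v k \<in> convex hull C" "\<And>j. (\<lambda>k. f j (v k)) \<longlonglongrightarrow> f j y" for v
  proof (rule limitin_weak_of_dense_sequence[OF C(1) y f _ v])
    fix g assume "g \<in> dual" "\<And>x. \<bar>g x\<bar> \<le> nrm x" "\<And>c. c \<in> C \<Longrightarrow> \<bar>g c\<bar> \<le> 1"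
    then have "g \<in> L" by (simp add: L_def)
    then show "\<exists>q. \<forall>c\<in>C. (\<lambda>n. f (q n) c) \<longlonglongrightarrow> g c" using dense C(3) K(2) by blast
  qed
  have "limitin (weak_topology N) (\<lambda>k. z (s k)) y sequentially"
    using z z_lim by (rule test)
  then have "limitin (weak_topology N) (\<lambda>k. T (z (s k))) (T y) sequentially"
    by (rule weakly_sequentially_continuous_onD[OF T(2) zK subsetD[OF C(3) y]])
  moreover have "limitin (weak_topology N) (\<lambda>k. T (z (s k))) y sequentially"
    by (rule test) (use TzC Tz_lim in \<open>auto intro: hull_inc\<close>)
  ultimately have "T y = y" by (rule limitin_weak_unique)
  with y C(3) show ?thesis by blast
qed

section \<open>Reduction to a separable closed convex set\<close>

lemma convex_closure_of_rational_convex: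
  assumes D: "\<And>a b q. a \<in> D \<Longrightarrow> b \<in> D \<Longrightarrow> q \<in> \<rat> \<inter> {0..1} \<Longrightarrow> (1 - q) *\<^sub>R a + q *\<^sub>R b \<in> D"
  shows "convex (gtopology N closure_of D)"
  unfolding convex_alt
proof (intro ballI allI impI)
  fix x y and t :: real
  assume x: "x \<in> gtopology N closure_of D" and y: "y \<in> gtopology N closure_of D" and t: "0 \<le> t \<and> t \<le> 1"
  show "(1 - t) *\<^sub>R x + t *\<^sub>R y \<in> gtopology N closure_of D"
    unfolding in_closure_of
  proof (intro allI impI)
    fix e :: real assume "0 < e"
    then have "0 < e / 3" by simp
    then obtain a b where a: "a \<in> D" "nrm (x - a) < e / 3" and b: "b \<in> D" "nrm (y - b) < e / 3"
      using x y unfolding in_closure_of by blast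
    \<comment> \<open>Changing the weight costs less than a third of \<open>e\<close>, and replacing
      \<open>x\<close>, \<open>y\<close> by \<open>a\<close>, \<open>b\<close> at most another
      third; the added 1 covers \<open>y = x\<close>.\<close>
    define \<eta> where "\<eta> = e / 3 / (nrm (y - x) + 1)"
    have "0 < nrm (y - x) + 1" by (simp add: add_nonneg_pos)
    then have \<eta>: "0 < \<eta>" "\<eta> * nrm (y - x) < e / 3" using \<open>0 < e\<close> by (simp_all add: \<eta>_def field_simps)
    \<comment> \<open>Approximation from below keeps \<open>q\<close> in the unit interval; for
      \<open>t = 0\<close> the weight 0 itself is taken.\<close>
    have "\<exists>q\<in>\<rat> \<inter> {0..1}. \<bar>t - q\<bar> < \<eta>"
    proof (cases "t = 0")
      case True
      then show ?thesis using \<eta> by (intro bexI[of _ 0]) auto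
    next
      case False
      then have "max 0 (t - \<eta>) < t" using t \<eta> by simp
      then obtain q where "q \<in> \<rat>" "max 0 (t - \<eta>) < q" "q < t"
        using Rats_dense_in_real by blast
      then show ?thesis using t by (intro bexI[of _ q]) auto
    qed
    then obtain q where q: "q \<in> \<rat> \<inter> {0..1}" "\<bar>t - q\<bar> < \<eta>" by blast
    define u where "u = (1 - q) *\<^sub>R (x - a) + q *\<^sub>R (y - b)"
    have "(1 - t) *\<^sub>R x + t *\<^sub>R y - ((1 - q) *\<^sub>R a + q *\<^sub>R b) = (t - q) *\<^sub>R (y - x) + u"
      by (simp add: u_def algebra_simps)
    then have "nrm ((1 - t) *\<^sub>R x + t *\<^sub>R y - ((1 - q) *\<^sub>R a + q *\<^sub>R b)) \<le> \<bar>t - q\<bar> * nrm (y - x) + nrm u"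
      using nrm_triangle[of "(t - q) *\<^sub>R (y - x)" u] by (simp add: nrm_scaleR)
    moreover have "\<bar>t - q\<bar> * nrm (y - x) \<le> \<eta> * nrm (y - x)"
      using q(2) by (intro mult_right_mono) auto
    moreover have "nrm u \<le> (1 - q) * nrm (x - a) + q * nrm (y - b)"
      using nrm_triangle[of "(1 - q) *\<^sub>R (x - a)" "q *\<^sub>R (y - b)"] q(1) by (simp add: u_def nrm_scaleR)
    moreover have "(1 - q) * nrm (x - a) + q * nrm (y - b) \<le> (1 - q) * (e / 3) + q * (e / 3)"
      using q(1) a b by (intro add_mono mult_left_mono) auto
    moreover have "(1 - q) * (e / 3) + q * (e / 3) = e / 3" by (simp flip: distrib_right)
    ultimately have "nrm ((1 - t) *\<^sub>R x + t *\<^sub>R y - ((1 - q) *\<^sub>R a + q *\<^sub>R b)) < e"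
      using \<eta>(2) \<open>0 < e\<close> by linarith
    then show "\<exists>v\<in>D. nrm ((1 - t) *\<^sub>R x + t *\<^sub>R y - v) < e" using D[OF a(1) b(1) q(1)] by blast
  qed
qed

theorem fixed_point_weakly_compact:
  assumes "S \<noteq> {}" and S: "closedin (gtopology N) S" "convex S"
    and T: "T ` S \<subseteq> S" "weakly_sequentially_continuous_on N S T"
    and cpt: "relatively_weakly_compact N (T ` S)"
  shows "\<exists>x\<in>S. T x = x"
proof -
  obtain x0 where x0: "x0 \<in> S" using \<open>S \<noteq> {}\<close> by blast
  obtain D where DS: "countable D \<and> x0 \<in> D \<and> D \<subseteq> S \<and> T ` D \<subseteq> D \<and>
      (\<forall>a\<in>D. \<forall>b\<in>D. \<forall>q\<in>\<rat> \<inter> {0..1}. (1 - q) *\<^sub>R a + q *\<^sub>R b \<in> D)"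
    using countable_invariant_rational_convex[OF x0 S(2) T(1)] by (rule exE)
  then have D: "countable D" "x0 \<in> D" "D \<subseteq> S" "T ` D \<subseteq> D"
    and D_conv: "\<And>a b q. a \<in> D \<Longrightarrow> b \<in> D \<Longrightarrow> q \<in> \<rat> \<inter> {0..1} \<Longrightarrow> (1 - q) *\<^sub>R a + q *\<^sub>R b \<in> D"
    by simp_all
  have "D \<noteq> {}" using D(2) by blast
  define K where "K = gtopology N closure_of D"
  have K: "closedin (gtopology N) K" "convex K"
    unfolding K_def by (simp, rule convex_closure_of_rational_convex[OF D_conv])
  have KS: "K \<subseteq> S" unfolding K_def using D(3) S(1) by (rule closure_of_minimal)
  have "D \<subseteq> K" unfolding K_def by (rule closure_of_subset) (use closedin_subset[OF S(1)] D(3) in blast)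
  have K_weak: "closedin (weak_topology N) K" using K by (rule closedin_weak)
  \<comment> \<open>A norm limit of points of \<open>D\<close> is also a weak limit, so
    \<open>T x\<close> is a weak limit of points of \<open>D\<close>, and \<open>K\<close> is weakly
    closed.\<close>
  have T_K: "T x \<in> K" if "x \<in> K" for x
  proof -
    have "\<forall>k. \<exists>a\<in>D. nrm (x - a) < inverse (real (Suc k))"
      using that unfolding K_def in_closure_of by simp
    then obtain a where a: "\<And>k. a k \<in> D" "\<And>k. nrm (x - a k) < inverse (real (Suc k))" by metis
    have "(\<lambda>k. nrm (a k - x)) \<longlonglongrightarrow> 0"
    proof (rule Lim_null_comparison[OF _ LIMSEQ_inverse_real_of_nat])
      have "nrm (a k - x) \<le> inverse (real (Suc k))" for k
        using a(2)[of k] nrm_minus[of "x - a k"] by simp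
      then show "\<forall>\<^sub>F k in sequentially. norm (nrm (a k - x)) \<le> inverse (real (Suc k))" by simp
    qed
    then have "limitin (weak_topology N) a x sequentially" by (rule limitin_weak_of_nrm)
    then have lim: "limitin (weak_topology N) (\<lambda>k. T (a k)) (T x) sequentially"
      by (rule weakly_sequentially_continuous_onD[OF T(2) subsetD[OF D(3) a(1)] subsetD[OF KS that]])
    have "T (a k) \<in> K" for k using a(1) D(4) \<open>D \<subseteq> K\<close> by blast
    then show ?thesis
      by (intro limitin_closedin[OF lim K_weak] always_eventually) simp_all
  qed
  \<comment> \<open>Intersecting with the weakly closed \<open>K\<close> preserves compactness and
    still catches the image of \<open>K\<close>, while putting \<open>C\<close> inside the separable
    set.\<close>
  define C where "C = weak_topology N closure_of (T ` S) \<inter> K"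
  have C: "compactin (weak_topology N) C"
    unfolding C_def
    by (rule compact_Int_closedin[OF cpt[unfolded relatively_weakly_compact_def] K_weak])
  have "T ` S \<subseteq> weak_topology N closure_of (T ` S)"
    by (rule closure_of_subset) (simp add: topspace_weak_topology)
  then have TC: "T ` K \<subseteq> C" using T_K KS unfolding C_def by blast
  have C_ne: "C \<noteq> {}" using TC \<open>D \<subseteq> K\<close> D(2) by blast
  have CK: "C \<subseteq> K" by (simp add: C_def)
  have K_sep: "K \<subseteq> gtopology N closure_of range (from_nat_into D)"
    unfolding K_def range_from_nat_into[OF \<open>D \<noteq> {}\<close> D(1)] by simp
  have "weakly_sequentially_continuous_on N K T"
    using T(2) KS by (rule weakly_sequentially_continuous_on_subset)
  then have "\<exists>x\<in>K. T x = x"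
    by (rule fixed_point_separable[OF C C_ne CK K(2) K_sep TC])
  with KS show ?thesis by blast
qed

end

theorem theorem2p2:
  fixes N :: "'a::real_vector \<Rightarrow> real ^ 'n"
    and S :: "'a set"
    and T :: "'a \<Rightarrow> 'a"
  assumes "generalized_banach_space N"
    and "S \<noteq> {}"
    and "closedin (gtopology N) S"
    and "convex S"
    and "T \<in> S \<rightarrow> S"
    and "weakly_sequentially_continuous_on N S T"
    and "relatively_weakly_compact N (T ` S)"
  shows "\<exists>x\<in>S. T x = x"
proof -
  interpret generalized_banach_space N by fact
  show ?thesis
    using assms by (intro fixed_point_weakly_compact) auto
qed

end
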